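(* Let $p$ be an odd prime and let $G$ be an Abelian group of order $8p^3$. Then every regular partial difference set in $G$ is trivial.
   Context: Let $G$ be a finite Abelian group of order $v$ with identity $e$, and $D\subseteq G$ a subset of size $k$. $D$ is a $(v,k,\lambda,\mu)$-partial difference set (PDS) in $G$ if the expressions $gh^{-1}$ with $g,h\in D$, $g\neq h$, represent each non-identity element of $D$ exactly $\lambda$ times and each non-identity element of $G$ not in $D$ exactly $\mu$ times. $D$ is regular if moreover $D^{(-1)}=\{g^{-1}:g\in D\}=D$ and $e\notin D$. A regular PDS $D$ is trivial if $D\cup\{e\}$ or $G\setminus D$ is a subgroup of $G$. *)

theory Defs
  imports "HOL-Algebra.Coset" "HOL-Computational_Algebra.Primes"
begin

definition quotient_reps :: "('a, 'b) monoid_scheme \<Rightarrow> 'a set \<Rightarrow> 'a \<Rightarrow> ('a \<times> 'a) set" where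
  "quotient_reps G D x =
     {(g, h). g \<in> D \<and> h \<in> D \<and> g \<noteq> h \<and> g \<otimes>\<^bsub>G\<^esub> inv\<^bsub>G\<^esub> h = x}"

definition partial_difference_set ::
  "('a, 'b) monoid_scheme \<Rightarrow> nat \<Rightarrow> nat \<Rightarrow> nat \<Rightarrow> nat \<Rightarrow> 'a set \<Rightarrow> bool" where
  "partial_difference_set G v k l m D \<longleftrightarrow>
     comm_group G \<and> finite (carrier G) \<and> order G = v \<and>
     D \<subseteq> carrier G \<and> card D = k \<and>
     (\<forall>x \<in> D - {\<one>\<^bsub>G\<^esub>}. card (quotient_reps G D x) = l) \<and>
     (\<forall>x \<in> carrier G - D - {\<one>\<^bsub>G\<^esub>}. card (quotient_reps G D x) = m)"

definition regular_partial_difference_set ::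
  "('a, 'b) monoid_scheme \<Rightarrow> nat \<Rightarrow> nat \<Rightarrow> nat \<Rightarrow> nat \<Rightarrow> 'a set \<Rightarrow> bool" where
  "regular_partial_difference_set G v k l m D \<longleftrightarrow>
     partial_difference_set G v k l m D \<and> set_inv\<^bsub>G\<^esub> D = D \<and> \<one>\<^bsub>G\<^esub> \<notin> D"

definition trivial_partial_difference_set :: "('a, 'b) monoid_scheme \<Rightarrow> 'a set \<Rightarrow> bool" where
  "trivial_partial_difference_set G D \<longleftrightarrow>
     subgroup (D \<union> {\<one>\<^bsub>G\<^esub>}) G \<or> subgroup (carrier G - D) G"

end

theory Submission
  imports Defs Complex_Main "HOL-Algebra.Sylow" "HOL-Algebra.Multiplicative_Group"
begin

text \<open>
  In the group ring, a regular partial difference set satisfies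
  \<open>D\<^sup>2 = - r s + (r + s) D + \<mu> G\<close>, where \<open>r\<close> and \<open>s\<close> are the values of the nontrivial characters
  on \<open>D\<close>; a character of order 2 shows that they are integers. If \<open>D\<close> is not trivial then
  \<open>s < - 1\<close> and \<open>0 < r\<close>. The nontrivial characters with value \<open>r\<close> form a partial difference set
  in the dual group. Its eigenvalues are integers, so \<open>\<delta> = r - s\<close> divides the order
  \<open>8 p\<^sup>3 = \<delta> \<delta>'\<close> and \<open>|D| - s = \<delta> (A + 1)\<close> for an integer \<open>A\<close>. With \<open>b = - s - 1\<close>
  the parameters satisfy the self-dual equation
  \<open>\<delta>' b (\<delta> - 1 - b) = \<delta> A (\<delta>' - 1 - A)\<close> with \<open>0 < b < \<delta> - 1\<close> and \<open>0 < A < \<delta>' - 1\<close>.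

  Up to duality \<open>p\<^sup>2\<close> does not divide \<open>\<delta>\<close>. The equation excludes
  \<open>\<delta> = 1, 2, 4, 8, p, 2 p\<close>, which leaves \<open>\<delta> = h p\<close> with \<open>h = 4\<close> or \<open>h = 8\<close>. Let \<open>Q\<close> be the
  Sylow 2-subgroup and let \<open>Y\<close> be the image of \<open>D - s\<close> in the group ring of \<open>G / Q\<close>, so that
  \<open>Y\<^sup>2 = h p Y + h\<^sup>2 B (G / Q)\<close> with \<open>p B = A (A + 1)\<close>. Since \<open>G / Q\<close> has odd order, squaring is
  injective on its group ring modulo 2, and repeated halving gives \<open>Y = h V\<close> with integral \<open>V\<close>
  and \<open>V\<^sup>2 = p V + B (G / Q)\<close>. Comparing the sum of the coefficients of \<open>V\<close> with the sum of their
  squares, by means of \<open>x \<le> x\<^sup>2\<close> and \<open>3 x \<le> x\<^sup>2 + 2\<close> for integers \<open>x\<close>, gives a contradiction.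
\<close>

section \<open>Convolution on finite Abelian groups\<close>

text \<open>The involution splits \<open>X\<close> into pairs \<open>{x, h x}\<close> on which
  \<open>f\<close> is constant, so each pair contributes an even amount. The induction removes one
  pair at a time.\<close>

lemma even_sum_involution:
  fixes f :: "'a \<Rightarrow> int"
  assumes "finite X" "\<And>x. x \<in> X \<Longrightarrow> h x \<in> X" "\<And>x. x \<in> X \<Longrightarrow> h (h x) = x"
    "\<And>x. x \<in> X \<Longrightarrow> h x \<noteq> x" "\<And>x. x \<in> X \<Longrightarrow> f (h x) = f x"
  shows "even (\<Sum>x\<in>X. f x)"
  using assms
proof (induction X rule: finite_psubset_induct)
  case (psubset X)
  show ?case
  proof (cases "X = {}")
    case False
    then obtain a where a: "a \<in> X" by blast
    define Y where "Y = X - {a, h a}"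
    have "even (\<Sum>x\<in>Y. f x)"
    proof (rule psubset.IH)
      show "Y \<subset> X" using a by (auto simp: Y_def)
      fix x assume x: "x \<in> Y"
      then show "h x \<in> Y"
        using psubset.prems(1,2)[of x] psubset.prems(2)[of a] a by (auto simp: Y_def)
    qed (use psubset.prems in \<open>auto simp: Y_def\<close>)
    moreover have "(\<Sum>x\<in>X. f x) = (\<Sum>x\<in>Y. f x) + (\<Sum>x\<in>{a, h a}. f x)"
      unfolding Y_def using a psubset.prems(1)[OF a] psubset.hyps
      by (intro sum.subset_diff) auto
    ultimately show ?thesis
      using psubset.prems(3,4)[OF a] by simp
  qed simp
qed

text \<open>Multiplication in the integral group ring, an element being represented by its
  coefficient function.\<close>

definition gconv :: "('a, 'b) monoid_scheme \<Rightarrow> ('a \<Rightarrow> int) \<Rightarrow> ('a \<Rightarrow> int) \<Rightarrow> 'a \<Rightarrow> int" where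
  "gconv G u w z = (\<Sum>x\<in>carrier G. u x * w (inv\<^bsub>G\<^esub> x \<otimes>\<^bsub>G\<^esub> z))"

context comm_group
begin

lemma bij_betw_translate:
  assumes "a \<in> carrier G"
  shows "bij_betw (\<lambda>x. a \<otimes> x) (carrier G) (carrier G)"
proof (rule bij_betwI[where g = "\<lambda>x. inv a \<otimes> x"])
  show "inv a \<otimes> (a \<otimes> x) = x" if "x \<in> carrier G" for x
    using assms that by (simp add: m_assoc[symmetric])
  show "a \<otimes> (inv a \<otimes> x) = x" if "x \<in> carrier G" for x
    using assms that by (simp add: m_assoc[symmetric])
qed (use assms in auto)

lemma sum_translate:
  assumes "a \<in> carrier G"
  shows "(\<Sum>x\<in>carrier G. f (a \<otimes> x)) = (\<Sum>x\<in>carrier G. f x)"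
  by (rule sum.reindex_bij_betw[OF bij_betw_translate[OF assms]])

text \<open>A multiplicative function extends linearly to a ring homomorphism on the group ring. The
  target ring is left general to cover the augmentation, complex characters, and evaluation of
  characters at a group element.\<close>

lemma sum_gconv_mult:
  fixes c :: "'a \<Rightarrow> 'c::comm_ring_1"
  assumes c: "\<And>x y. x \<in> carrier G \<Longrightarrow> y \<in> carrier G \<Longrightarrow> c (x \<otimes> y) = c x * c y"
  shows "(\<Sum>z\<in>carrier G. of_int (gconv G u w z) * c z) =
    (\<Sum>x\<in>carrier G. of_int (u x) * c x) * (\<Sum>y\<in>carrier G. of_int (w y) * c y)"
proof -
  have "(\<Sum>z\<in>carrier G. of_int (gconv G u w z) * c z) =
      (\<Sum>x\<in>carrier G. \<Sum>z\<in>carrier G. of_int (u x) * of_int (w (inv x \<otimes> z)) * c z)"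
    by (subst sum.swap) (simp add: gconv_def sum_distrib_right)
  also have "\<dots> = (\<Sum>x\<in>carrier G. \<Sum>y\<in>carrier G. of_int (u x) * of_int (w y) * c (x \<otimes> y))"
  proof (rule sum.cong[OF refl])
    fix x assume x: "x \<in> carrier G"
    have "(\<Sum>z\<in>carrier G. of_int (u x) * of_int (w (inv x \<otimes> z)) * c z) =
        (\<Sum>y\<in>carrier G. of_int (u x) * of_int (w (inv x \<otimes> (x \<otimes> y))) * c (x \<otimes> y))"
      by (rule sum_translate[OF x, symmetric])
    also have "\<dots> = (\<Sum>y\<in>carrier G. of_int (u x) * of_int (w y) * c (x \<otimes> y))"
      using x by (intro sum.cong refl) (simp add: m_assoc[symmetric])
    finally show "(\<Sum>z\<in>carrier G. of_int (u x) * of_int (w (inv x \<otimes> z)) * c z) = \<dots>" .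
  qed
  also have "\<dots> = (\<Sum>x\<in>carrier G. \<Sum>y\<in>carrier G. (of_int (u x) * c x) * (of_int (w y) * c y))"
    by (intro sum.cong refl) (simp add: c)
  finally show ?thesis by (simp add: sum_product)
qed

lemma sum_gconv: "(\<Sum>z\<in>carrier G. gconv G u w z) = sum u (carrier G) * sum w (carrier G)"
  using sum_gconv_mult[of "\<lambda>_. 1::int" u w] by simp

text \<open>The quotient \<open>t\<close> of \<open>x\<close> and \<open>z\<close> has
  \<open>t^2 = 1\<close>, and its power with the odd exponent \<open>order G\<close> is also the
  identity, so \<open>t\<close> is the identity.\<close>

lemma odd_order_square_inj:
  assumes "odd (order G)" "x \<in> carrier G" "z \<in> carrier G" "x \<otimes> x = z \<otimes> z"
  shows "x = z"
proof -
  obtain n where n: "order G = Suc (2 * n)" using assms(1) by (metis oddE Suc_eq_plus1)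
  define t where "t = x \<otimes> inv z"
  have t: "t \<in> carrier G" using assms by (simp add: t_def)
  have tt: "t \<otimes> t = \<one>"
  proof -
    have "t \<otimes> t = (x \<otimes> x) \<otimes> inv (z \<otimes> z)"
      using assms(2,3) by (simp add: t_def inv_mult m_ac)
    then show ?thesis using assms by simp
  qed
  have "t [^] order G = t \<otimes> (t \<otimes> t) [^] n"
  proof -
    have "t \<otimes> t = t [^] (2::nat)" using t by (simp add: numeral_2_eq_2)
    then show ?thesis
      using t n by (simp only: nat_pow_pow nat_pow_Suc2)
  qed
  then have "t = \<one>" using t tt pow_order_eq_1[OF t] by simp
  then show ?thesis using assms(2,3) unfolding t_def
    by (metis inv_closed inv_inv m_comm inv_equality)
qed

text \<open>The Frobenius congruence modulo 2: swapping the factors in the products contributing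
  to the coefficient of \<open>z\<^sup>2\<close> leaves only \<open>z \<cdot> z\<close> fixed.\<close>

lemma even_gconv_square:
  assumes fin: "finite (carrier G)" and "odd (order G)" and z: "z \<in> carrier G"
  shows "even (gconv G w w (z \<otimes> z) - w z)"
proof -
  define h where "h x = inv x \<otimes> (z \<otimes> z)" for x
  define f where "f x = w x * w (h x)" for x
  have h_closed: "h x \<in> carrier G" if "x \<in> carrier G" for x
    using that z by (simp add: h_def)
  have hh: "h (h x) = x" if "x \<in> carrier G" for x
    using that z by (simp add: h_def inv_mult m_ac)
  have hz: "h z = z" using z by (simp add: h_def m_assoc[symmetric])
  have fixed: "x = z" if "x \<in> carrier G" "h x = x" for x
  proof (rule odd_order_square_inj[OF assms(2) that(1) z])
    have "x \<otimes> x = x \<otimes> (inv x \<otimes> (z \<otimes> z))" using that by (simp add: h_def)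
    also have "\<dots> = z \<otimes> z" using that(1) z by (simp add: m_assoc[symmetric])
    finally show "x \<otimes> x = z \<otimes> z" .
  qed
  have "even (\<Sum>x\<in>carrier G - {z}. f x)"
  proof (rule even_sum_involution[where h = h])
    fix x assume x: "x \<in> carrier G - {z}"
    show "h x \<in> carrier G - {z}" using x h_closed hh hz by (metis Diff_iff insert_iff empty_iff)
    show "h (h x) = x" using x hh by simp
    show "h x \<noteq> x" using x fixed by auto
    show "f (h x) = f x" using x hh by (simp add: f_def)
  qed (simp add: fin)
  moreover have "gconv G w w (z \<otimes> z) = f z + (\<Sum>x\<in>carrier G - {z}. f x)"
    unfolding gconv_def f_def h_def using sum.remove[OF fin z] by blast
  moreover have "even (f z - w z)" by (simp add: f_def hz)
  ultimately show ?thesis by simp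
qed

text \<open>Modulo 2 the equation reads \<open>Y^2 = 0\<close>, so the Frobenius congruence makes
  every coefficient of \<open>Y\<close> even. The constants \<open>2 * d\<close> and
  \<open>4 * m\<close> are scaled so that the half satisfies an equation of the same shape, which
  allows iteration.\<close>

lemma gconv_quadratic_halve:
  assumes fin: "finite (carrier G)" and "odd (order G)"
    and Y: "\<And>z. z \<in> carrier G \<Longrightarrow> gconv G Y Y z = 2 * d * Y z + 4 * m"
  obtains V where "\<And>z. z \<in> carrier G \<Longrightarrow> Y z = 2 * V z"
    "\<And>z. z \<in> carrier G \<Longrightarrow> gconv G V V z = d * V z + m"
proof -
  have ev: "even (Y z)" if "z \<in> carrier G" for z
    using even_gconv_square[OF fin assms(2) that, of Y] Y[of "z \<otimes> z"] that by simp
  define V where "V z = Y z div 2" for z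
  have V: "Y z = 2 * V z" if "z \<in> carrier G" for z using ev[OF that] by (simp add: V_def)
  have "gconv G V V z = d * V z + m" if z: "z \<in> carrier G" for z
  proof -
    have "gconv G Y Y z = (\<Sum>x\<in>carrier G. 4 * (V x * V (inv x \<otimes> z)))"
      unfolding gconv_def using z by (intro sum.cong refl) (simp add: V)
    also have "\<dots> = 4 * gconv G V V z" by (simp add: gconv_def sum_distrib_left)
    finally show ?thesis using Y[OF z] V[OF z] by simp
  qed
  with V show thesis using that by blast
qed

end

section \<open>Images in the group ring under homomorphisms\<close>

definition pushforward ::
  "('a, 'c) monoid_scheme \<Rightarrow> ('a \<Rightarrow> 'b) \<Rightarrow> ('a \<Rightarrow> int) \<Rightarrow> 'b \<Rightarrow> int" where
  "pushforward G h u y = (\<Sum>x | x \<in> carrier G \<and> h x = y. u x)"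

text \<open>The linear extension of a homomorphism is multiplicative: the sum over \<open>H\<close>
  of sums over fibres collapses to a sum over \<open>G\<close>.\<close>

lemma gconv_pushforward:
  assumes G: "comm_group G" and H: "comm_group H"
    and fin: "finite (carrier G)" "finite (carrier H)"
    and h: "h \<in> hom G H" and y: "y \<in> carrier H"
  shows "gconv H (pushforward G h u) (pushforward G h w) y = pushforward G h (gconv G u w) y"
proof -
  interpret G: comm_group G by fact
  interpret H: comm_group H by fact
  interpret h: group_hom G H h using h by unfold_locales
  \<comment> \<open>Left translation by \<open>x\<close> carries the fibre over
    \<open>(h x)^-1 y\<close> bijectively onto the fibre over \<open>y\<close>.\<close>
  have pw: "pushforward G h w (inv\<^bsub>H\<^esub> (h x) \<otimes>\<^bsub>H\<^esub> y) =
      (\<Sum>z | z \<in> carrier G \<and> h z = y. w (inv\<^bsub>G\<^esub> x \<otimes>\<^bsub>G\<^esub> z))" if x: "x \<in> carrier G" for x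
    unfolding pushforward_def
  proof (rule sum.reindex_bij_witness[of _ "\<lambda>z. inv\<^bsub>G\<^esub> x \<otimes>\<^bsub>G\<^esub> z" "\<lambda>t. x \<otimes>\<^bsub>G\<^esub> t"])
    fix t assume "t \<in> {t \<in> carrier G. h t = inv\<^bsub>H\<^esub> h x \<otimes>\<^bsub>H\<^esub> y}"
    then have t: "t \<in> carrier G" "h t = inv\<^bsub>H\<^esub> h x \<otimes>\<^bsub>H\<^esub> y" by auto
    show "inv\<^bsub>G\<^esub> x \<otimes>\<^bsub>G\<^esub> (x \<otimes>\<^bsub>G\<^esub> t) = t" using x t by (simp add: G.m_assoc[symmetric])
    show "x \<otimes>\<^bsub>G\<^esub> t \<in> {z \<in> carrier G. h z = y}"
      using x t y by (simp add: H.m_assoc[symmetric])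
    show "w (inv\<^bsub>G\<^esub> x \<otimes>\<^bsub>G\<^esub> (x \<otimes>\<^bsub>G\<^esub> t)) = w t" using x t by (simp add: G.m_assoc[symmetric])
  next
    fix z assume z: "z \<in> {z \<in> carrier G. h z = y}"
    show "x \<otimes>\<^bsub>G\<^esub> (inv\<^bsub>G\<^esub> x \<otimes>\<^bsub>G\<^esub> z) = z" using x z by (simp add: G.m_assoc[symmetric])
    show "inv\<^bsub>G\<^esub> x \<otimes>\<^bsub>G\<^esub> z \<in> {t \<in> carrier G. h t = inv\<^bsub>H\<^esub> h x \<otimes>\<^bsub>H\<^esub> y}" using x z by simp
  qed
  have "gconv H (pushforward G h u) (pushforward G h w) y =
      (\<Sum>a\<in>carrier H. \<Sum>x | x \<in> carrier G \<and> h x = a.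
         u x * pushforward G h w (inv\<^bsub>H\<^esub> (h x) \<otimes>\<^bsub>H\<^esub> y))"
    unfolding gconv_def pushforward_def[of G h u] sum_distrib_right
    by (intro sum.cong refl) auto
  also have "\<dots> = (\<Sum>x\<in>carrier G. u x * pushforward G h w (inv\<^bsub>H\<^esub> (h x) \<otimes>\<^bsub>H\<^esub> y))"
    by (rule sum.group) (use fin in auto)
  also have "\<dots> = (\<Sum>x\<in>carrier G. \<Sum>z | z \<in> carrier G \<and> h z = y. u x * w (inv\<^bsub>G\<^esub> x \<otimes>\<^bsub>G\<^esub> z))"
    by (intro sum.cong refl) (simp add: pw sum_distrib_left)
  also have "\<dots> = pushforward G h (gconv G u w) y"
    unfolding pushforward_def gconv_def by (rule sum.swap)
  finally show ?thesis .
qed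

section \<open>The image in the odd-order quotient\<close>

text \<open>This expands \<open>(u - s)^2\<close>. If \<open>u^2 = - r s + (r + s) u + m G\<close>,
  then \<open>(u - s)^2 = (r - s) (u - s) + m G\<close>, so the shift removes the separate identity
  term.\<close>

lemma (in comm_group) gconv_diff_one:
  assumes fin: "finite (carrier G)" and z: "z \<in> carrier G"
  shows "gconv G (\<lambda>x. u x - s * of_bool (x = \<one>)) (\<lambda>x. u x - s * of_bool (x = \<one>)) z =
    gconv G u u z - 2 * s * u z + s\<^sup>2 * of_bool (z = \<one>)"
proof -
  have eq: "inv x \<otimes> z = \<one> \<longleftrightarrow> x = z" if "x \<in> carrier G" for x
    using that z by (metis inv_closed inv_comm inv_equality inv_inv l_inv)
  have "gconv G (\<lambda>x. u x - s * of_bool (x = \<one>)) (\<lambda>x. u x - s * of_bool (x = \<one>)) z =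
      (\<Sum>x\<in>carrier G. u x * u (inv x \<otimes> z)
        - (if x = z then s * u x else 0) - (if x = \<one> then s * u (inv x \<otimes> z) else 0)
        + (if x = z then s\<^sup>2 * of_bool (x = \<one>) else 0))"
    unfolding gconv_def
    by (intro sum.cong refl) (auto simp: eq algebra_simps power2_eq_square)
  also have "\<dots> = gconv G u u z - 2 * s * u z + s\<^sup>2 * of_bool (z = \<one>)"
    using fin z by (simp add: sum.distrib sum_subtractf gconv_def)
  finally show ?thesis .
qed

text \<open>The difference set condition in the group ring, parametrised by the eigenvalues:
  \<open>- r s\<close> is \<open>k - \<mu>\<close>, \<open>r + s\<close> is
  \<open>\<lambda> - \<mu>\<close>, and \<open>m\<close> is \<open>\<mu>\<close>. The dual
  difference set satisfies an equation of the same form.\<close>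

definition pds_equation :: "('a, 'b) monoid_scheme \<Rightarrow> 'a set \<Rightarrow> int \<Rightarrow> int \<Rightarrow> int \<Rightarrow> bool" where
  "pds_equation G D r s m \<longleftrightarrow>
     D \<subseteq> carrier G \<and> \<one>\<^bsub>G\<^esub> \<notin> D \<and> (\<forall>x\<in>D. inv\<^bsub>G\<^esub> x \<in> D) \<and>
     (\<forall>z\<in>carrier G. gconv G (\<lambda>x. of_bool (x \<in> D)) (\<lambda>x. of_bool (x \<in> D)) z =
        - (r * s) * of_bool (z = \<one>\<^bsub>G\<^esub>) + (r + s) * of_bool (z \<in> D) + m)"

text \<open>The witness \<open>e\<close> is the identity coefficient of \<open>V\<close>. The
  integer inequalities are summed over the \<open>n - 1\<close> other elements of the quotient,
  where the coefficients of \<open>V\<close> have sum \<open>(A + 1) q - e\<close> and sum of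
  squares \<open>q e + B - e^2\<close>.\<close>

lemma odd_quotient_inequalities:
  fixes G (structure)
  assumes G: "comm_group G" and fin: "finite (carrier G)"
    and n: "order G = 8 * n" "odd n"
    and D: "pds_equation G D r s m"
    and h: "h = 4 \<or> h = 8" and rs: "r - s = h * q" and m: "8 * m = h\<^sup>2 * B"
    and k: "int (card D) - s = h * q * (A + 1)"
  obtains e :: int where
    "(A + 1) * q - e \<le> q * e + B - e\<^sup>2"
    "3 * ((A + 1) * q - e) \<le> q * e + B - e\<^sup>2 + 2 * (int n - 1)"
proof -
  interpret G: comm_group G by fact
  obtain Q where Q: "subgroup Q G" "card Q = 8"
    using sylow_thm[of 2 G 3 n] G.group_axioms n fin by auto
  define H where "H = G Mod Q"
  define \<pi> where "\<pi> = (\<lambda>a. Q #> a)"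
  define u :: "_ \<Rightarrow> int" where "u x = of_bool (x \<in> D)" for x
  have normal: "Q \<lhd> G" using Q(1) G.subgroup_imp_normal by blast
  interpret H: comm_group H unfolding H_def by (rule G.abelian_FactGroup[OF Q(1)])
  have hom: "\<pi> \<in> hom G H" unfolding \<pi>_def H_def by (rule normal.r_coset_hom_Mod[OF normal])
  interpret pi: group_hom G H \<pi> using hom by unfold_locales
  have car: "carrier H = \<pi> ` carrier G" by (simp add: H_def \<pi>_def carrier_FactGroup)
  have finH: "finite (carrier H)" using car fin by simp
  have "order H * 8 = order G"
    using G.lagrange[OF Q(1)] Q(2) by (simp add: order_def H_def FactGroup_def)
  then have ordH: "order H = n" using n by simp
  have oddH: "odd (order H)" using ordH n by simp
  \<comment> \<open>The fibres are the cosets of \<open>Q\<close>; hence the constant function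
    \<open>m\<close> pushes forward to \<open>8 * m\<close>.\<close>
  have fiber: "card {x \<in> carrier G. \<pi> x = y} = 8" if y: "y \<in> carrier H" for y
  proof -
    have cos: "y \<in> rcosets Q" using y by (simp add: H_def FactGroup_def)
    have "{x \<in> carrier G. \<pi> x = y} = y"
    proof (intro Set.set_eqI iffI)
      fix x assume "x \<in> {x \<in> carrier G. \<pi> x = y}"
      then show "x \<in> y" using G.rcos_self[OF _ Q(1)] by (auto simp: \<pi>_def)
    next
      fix x assume x: "x \<in> y"
      obtain a where a: "a \<in> carrier G" "y = Q #> a" using y car \<pi>_def by auto
      have "x \<in> carrier G" using x a G.r_coset_subset_G[OF subgroup.subset[OF Q(1)]] by blast
      moreover have "Q #> a = Q #> x" using G.repr_independence x a Q(1) by blast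
      ultimately show "x \<in> {x \<in> carrier G. \<pi> x = y}" using a by (simp add: \<pi>_def)
    qed
    then show ?thesis
      using G.card_rcosets_equal[OF cos] Q subgroup.subset by metis
  qed
  have Dsub: "D \<subseteq> carrier G" and Dinv: "\<And>x. x \<in> D \<Longrightarrow> inv x \<in> D"
    and conv: "\<And>z. z \<in> carrier G \<Longrightarrow> gconv G u u z = - (r * s) * of_bool (z = \<one>) + (r + s) * u z + m"
    using D unfolding pds_equation_def u_def by auto
  define c where "c = pushforward G \<pi> u"
  define Y where "Y y = c y - s * of_bool (y = \<one>\<^bsub>H\<^esub>)" for y
  have cc: "gconv H c c y = - (r * s) * of_bool (y = \<one>\<^bsub>H\<^esub>) + (r + s) * c y + 8 * m"
    if y: "y \<in> carrier H" for y
  proof -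
    have "gconv H c c y = pushforward G \<pi> (gconv G u u) y"
      unfolding c_def by (rule gconv_pushforward[OF G _ fin finH hom y]) unfold_locales
    also have "\<dots> = (\<Sum>x | x \<in> carrier G \<and> \<pi> x = y.
        (if x = \<one> then - (r * s) else 0) + (r + s) * u x + m)"
      unfolding pushforward_def by (intro sum.cong refl) (simp add: conv)
    also have "\<dots> = (\<Sum>x | x \<in> carrier G \<and> \<pi> x = y. if x = \<one> then - (r * s) else 0)
        + (r + s) * c y + 8 * m"
      by (simp add: sum.distrib sum_distrib_left c_def pushforward_def fiber[OF y])
    also have "(\<Sum>x | x \<in> carrier G \<and> \<pi> x = y. if x = \<one> then - (r * s) else 0) =
        - (r * s) * of_bool (y = \<one>\<^bsub>H\<^esub>)"
      using fin by (auto simp: sum.delta')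
    finally show ?thesis .
  qed
  have YY: "gconv H Y Y y = h * q * Y y + h\<^sup>2 * B" if y: "y \<in> carrier H" for y
  proof -
    have "gconv H Y Y y = gconv H c c y - 2 * s * c y + s\<^sup>2 * of_bool (y = \<one>\<^bsub>H\<^esub>)"
      unfolding Y_def by (rule H.gconv_diff_one[OF finH y])
    also have "\<dots> = (r - s) * Y y + 8 * m"
      by (simp add: cc[OF y] Y_def algebra_simps power2_eq_square)
    finally show ?thesis by (simp add: rs m)
  qed
  have sumY: "sum Y (carrier H) = h * q * (A + 1)"
  proof -
    have "sum c (carrier H) = sum u (carrier G)"
      unfolding c_def pushforward_def by (rule sum.group) (use fin finH in auto)
    also have "\<dots> = int (card D)"
    proof -
      have "sum u (carrier G) = sum u D"
        by (rule sum.mono_neutral_right) (use fin Dsub in \<open>auto simp: u_def\<close>)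
      then show ?thesis by (simp add: u_def)
    qed
    finally have "sum c (carrier H) = int (card D)" .
    moreover have "(\<Sum>y\<in>carrier H. s * of_bool (y = \<one>\<^bsub>H\<^esub>)) = (\<Sum>y\<in>carrier H. if y = \<one>\<^bsub>H\<^esub> then s else 0)"
      by (intro sum.cong refl) simp
    moreover have "sum Y (carrier H) = sum c (carrier H) - (\<Sum>y\<in>carrier H. s * of_bool (y = \<one>\<^bsub>H\<^esub>))"
      unfolding sum_subtractf[symmetric] by (rule sum.cong) (simp_all only: Y_def)
    ultimately show ?thesis using finH k by simp
  qed
  \<comment> \<open>This symmetry passes to \<open>V\<close> and turns the identity coefficient of
    \<open>V^2\<close> into the sum of the squares of the coefficients.\<close>
  have Yinv: "Y (inv\<^bsub>H\<^esub> y) = Y y" if y: "y \<in> carrier H" for y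
  proof -
    have "c (inv\<^bsub>H\<^esub> y) = c y" unfolding c_def pushforward_def
      by (rule sum.reindex_bij_witness[of _ "\<lambda>x. inv x" "\<lambda>x. inv x"])
        (use y Dinv in \<open>auto simp: u_def of_bool_def, (metis G.inv_inv)+\<close>)
    moreover have "inv\<^bsub>H\<^esub> y = \<one>\<^bsub>H\<^esub> \<longleftrightarrow> y = \<one>\<^bsub>H\<^esub>" using y by simp
    ultimately show ?thesis by (simp add: Y_def)
  qed
  \<comment> \<open>Each halving replaces \<open>h\<close> by \<open>h div 2\<close> in the equation
    \<open>Y^2 = h q Y + h^2 B\<close>. Two halvings reach 1 from \<open>h = 4\<close>, three from
    \<open>h = 8\<close>.\<close>
  have "\<exists>V. (\<forall>z\<in>carrier H. Y z = h * V z) \<and> (\<forall>z\<in>carrier H. gconv H V V z = q * V z + B)"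
  proof -
    obtain V1 where V1: "\<And>z. z \<in> carrier H \<Longrightarrow> Y z = 2 * V1 z"
      "\<And>z. z \<in> carrier H \<Longrightarrow> gconv H V1 V1 z = (h div 2 * q) * V1 z + (h div 2)\<^sup>2 * B"
      by (rule H.gconv_quadratic_halve[OF finH oddH, of Y "h div 2 * q" "(h div 2)\<^sup>2 * B"])
        (use YY h in auto)
    obtain V2 where V2: "\<And>z. z \<in> carrier H \<Longrightarrow> V1 z = 2 * V2 z"
      "\<And>z. z \<in> carrier H \<Longrightarrow> gconv H V2 V2 z = (h div 4 * q) * V2 z + (h div 4)\<^sup>2 * B"
      by (rule H.gconv_quadratic_halve[OF finH oddH, of V1 "h div 4 * q" "(h div 4)\<^sup>2 * B"])
        (use V1(2) h in auto)
    show ?thesis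
    proof (cases "h = 4")
      case True
      then show ?thesis using V1 V2 by (intro exI[of _ V2]) auto
    next
      case False
      then have h8: "h = 8" using h by simp
      obtain V3 where "\<And>z. z \<in> carrier H \<Longrightarrow> V2 z = 2 * V3 z"
        "\<And>z. z \<in> carrier H \<Longrightarrow> gconv H V3 V3 z = q * V3 z + B"
        by (rule H.gconv_quadratic_halve[OF finH oddH, of V2 q B]) (use V2(2) h8 in auto)
      then show ?thesis using V1 V2 h8 by (intro exI[of _ V3]) auto
    qed
  qed
  then obtain V where V: "\<And>z. z \<in> carrier H \<Longrightarrow> Y z = h * V z"
    "\<And>z. z \<in> carrier H \<Longrightarrow> gconv H V V z = q * V z + B" by blast
  define e where "e = V \<one>\<^bsub>H\<^esub>"
  have h0: "h \<noteq> 0" using h by auto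
  have "h * sum V (carrier H) = sum Y (carrier H)" by (simp add: V(1) sum_distrib_left)
  then have sumV: "sum V (carrier H) = (A + 1) * q" using sumY h0 by simp
  have sumV2: "(\<Sum>x\<in>carrier H. (V x)\<^sup>2) = q * e + B"
  proof -
    have "gconv H V V \<one>\<^bsub>H\<^esub> = (\<Sum>x\<in>carrier H. (V x)\<^sup>2)"
      unfolding gconv_def
    proof (rule sum.cong[OF refl])
      fix x assume x: "x \<in> carrier H"
      have "V (inv\<^bsub>H\<^esub> x) = V x" using V(1)[OF x] V(1)[of "inv\<^bsub>H\<^esub> x"] Yinv[OF x] x h0 by simp
      then show "V x * V (inv\<^bsub>H\<^esub> x \<otimes>\<^bsub>H\<^esub> \<one>\<^bsub>H\<^esub>) = (V x)\<^sup>2" using x by (simp add: power2_eq_square)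
    qed
    then show ?thesis using V(2)[of "\<one>\<^bsub>H\<^esub>"] by (simp add: e_def)
  qed
  let ?R = "carrier H - {\<one>\<^bsub>H\<^esub>}"
  have R1: "sum V ?R = (A + 1) * q - e"
    using sumV sum.remove[OF finH H.one_closed, of V] by (simp add: e_def)
  have R2: "(\<Sum>x\<in>?R. (V x)\<^sup>2) = q * e + B - e\<^sup>2"
    using sumV2 sum.remove[OF finH H.one_closed, of "\<lambda>x. (V x)\<^sup>2"] by (simp add: e_def)
  have cR: "int (card ?R) = int n - 1"
    using ordH finH H.order_gt_0_iff_finite by (simp add: order_def of_nat_diff)
  \<comment> \<open>No integer lies strictly between 0 and 1 or between 1 and 2, so both products of
    consecutive integers are nonnegative.\<close>
  have "x \<le> x\<^sup>2" "3 * x \<le> x\<^sup>2 + 2" for x :: int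
  proof -
    have "0 \<le> x * (x - 1)" by (cases "x \<le> 0") (auto simp: zero_le_mult_iff)
    then show "x \<le> x\<^sup>2" by (simp add: power2_eq_square algebra_simps)
    have "0 \<le> (x - 1) * (x - 2)" by (cases "x \<le> 1") (auto simp: zero_le_mult_iff)
    then show "3 * x \<le> x\<^sup>2 + 2" by (simp add: power2_eq_square algebra_simps)
  qed
  then have "sum V ?R \<le> (\<Sum>x\<in>?R. (V x)\<^sup>2)" "(\<Sum>x\<in>?R. 3 * V x) \<le> (\<Sum>x\<in>?R. (V x)\<^sup>2 + 2)"
    by (auto intro!: sum_mono)
  then show thesis
    using that[of e] R1 R2 cR by (simp add: sum.distrib sum_distrib_left[symmetric])
qed

section \<open>Arithmetic of the parameters\<close>

text \<open>Expanding \<open>(x - c) (y - c) >= 0\<close> shows that, for a fixed sum, the product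
  is least when one factor sits at the bound \<open>c\<close>.\<close>

lemma mult_ge_if_sum_fixed:
  fixes x y c S :: int
  assumes "c \<le> x" "c \<le> y" "x + y = S"
  shows "c * (S - c) \<le> x * y"
proof -
  have "0 \<le> (x - c) * (y - c)" using assms by simp
  then show ?thesis using assms(3)[symmetric] by (simp add: algebra_simps)
qed

lemma four_mult_le_square:
  fixes x y :: int
  shows "4 * (x * y) \<le> (x + y)\<^sup>2"
proof -
  have "0 \<le> (x - y)\<^sup>2" by simp
  then show ?thesis by (simp add: power2_eq_square algebra_simps)
qed

text \<open>\<open>A\<close> is congruent to 0 or -1 modulo \<open>p\<close>, and the reflection
  \<open>A -> p t - 1 - A\<close> exchanges these two classes. A positive member of either class is
  at least \<open>p - 1\<close>.\<close>

lemma prime_dvd_mult_succ_bounds: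
  fixes p A t :: int
  assumes "prime p" "p dvd A * (A + 1)" "0 < A" "A < p * t - 1"
  shows "p - 1 \<le> A" "p - 1 \<le> p * t - 1 - A"
proof -
  have d: "p dvd A \<or> p dvd A + 1" using assms(1,2) prime_dvd_mult_iff by blast
  then show "p - 1 \<le> A" using assms(3) zdvd_imp_le[of p A] zdvd_imp_le[of p "A + 1"] by auto
  have "p dvd p * t - A \<or> p dvd p * t - 1 - A"
    using d by (metis dvd_triv_left dvd_diff diff_diff_eq add.commute)
  then show "p - 1 \<le> p * t - 1 - A"
    using assms(4) zdvd_imp_le[of p "p * t - A"] zdvd_imp_le[of p "p * t - 1 - A"] by auto
qed

text \<open>For \<open>d = 1, 2\<close> there is no room for \<open>b\<close>. For
  \<open>d = 4\<close> the product with \<open>A\<close> is forced to be \<open>p^3\<close>, which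
  is too small. For \<open>d = 8\<close> the cube \<open>p^3\<close> would divide
  \<open>A (A + 1)\<close>. For \<open>d = p, 2 p\<close> the lower bound on the \<open>A\<close>
  side exceeds the maximum of the \<open>b\<close> side.\<close>

lemma no_small_eigenvalue_gap:
  fixes p d d' b A :: int
  assumes p: "prime p" "odd p" and dd: "d * d' = 8 * p ^ 3"
    and d: "d \<in> {1, 2, 4, 8, p, 2 * p}"
    and b: "0 < b" "b < d - 1" and A: "0 < A" "A < d' - 1"
    and eq: "d' * (b * (d - 1 - b)) = d * (A * (d' - 1 - A))"
  shows False
proof -
  have p3: "3 \<le> p" using p prime_ge_2_int[of p] by (cases "p = 2") auto
  consider "d = 1 \<or> d = 2" | "d = 4" | "d = 8" | "d = p \<or> d = 2 * p"
    using d by auto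
  then show False
  proof cases
    case 1
    then show False using b by auto
  next
    case 2
    have d': "d' = 2 * p ^ 3" using dd 2 by simp
    have "b = 1 \<or> b = 2" using b 2 by auto
    then have "b * (d - 1 - b) = 2" using 2 by auto
    then have "A * (d' - 1 - A) = p ^ 3" using eq 2 d' by simp
    moreover have "1 * (d' - 1 - 1) \<le> A * (d' - 1 - A)"
      using A by (intro mult_ge_if_sum_fixed) auto
    moreover have "3 ^ 3 \<le> p ^ 3" using p3 by (intro power_mono) auto
    ultimately show False using d' by simp
  next
    case 3
    have d': "d' = p ^ 3" using dd 3 by simp
    have "coprime (p ^ 3) (2 ^ 3)"
      unfolding coprime_power_left_iff coprime_power_right_iff using p(2) by simp
    then have cop: "coprime (p ^ 3) 8" by simp
    have "p ^ 3 dvd 8 * (A * (d' - 1 - A))" using eq 3 d' by (metis dvd_triv_left)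
    then have "p ^ 3 dvd A * (p ^ 3 - (A + 1))"
      using cop d' by (simp add: coprime_dvd_mult_right_iff diff_diff_eq add.commute)
    then have "p ^ 3 dvd A * p ^ 3 - A * (p ^ 3 - (A + 1))" by (intro dvd_diff) auto
    then have dv: "p ^ 3 dvd A * (A + 1)" by (simp add: algebra_simps)
    \<comment> \<open>Only one of the neighbours \<open>A\<close> and \<open>A + 1\<close> can be
      divisible by \<open>p\<close>, so it absorbs all of \<open>p^3\<close>; but both are positive
      and less than \<open>p^3\<close>.\<close>
    show False
    proof (cases "p dvd A")
      case True
      then have "\<not> p dvd A + 1" using p(1) by (metis dvd_add_right_iff not_prime_unit)
      then have "coprime (p ^ 3) (A + 1)" using p(1) by (simp add: prime_imp_coprime)
      then have "p ^ 3 dvd A" using dv by (simp add: coprime_dvd_mult_left_iff)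
      then show False using A d' zdvd_imp_le[of "p ^ 3" A] by simp
    next
      case False
      then have "coprime (p ^ 3) A" using p(1) by (simp add: prime_imp_coprime)
      then have "p ^ 3 dvd A + 1" using dv by (simp add: coprime_dvd_mult_right_iff)
      then show False using A d' zdvd_imp_le[of "p ^ 3" "A + 1"] by simp
    qed
  next
    case 4
    then obtain t where 4: "t = 1 \<or> t = 2" "d = t * p" by (metis mult_1)
    have d': "t * d' = p * (8 * p)" using dd 4 p3 by (simp add: power3_eq_cube)
    \<comment> \<open>The cofactor in \<open>d' = p * u\<close>, that is \<open>8 p\<close> for
      \<open>d = p\<close> and \<open>4 p\<close> for \<open>d = 2 p\<close>.\<close>
    define u where "u = (if t = 1 then 8 else 4) * p"
    have du: "d' = p * u" "t * u = 8 * p" using d' 4(1) by (auto simp: u_def)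
    have "p * (u * (b * (d - 1 - b))) = p * (t * (A * (d' - 1 - A)))"
      using eq du 4 by (simp add: algebra_simps)
    then have eq2: "u * (b * (d - 1 - b)) = t * (A * (d' - 1 - A))" using p3 by simp
    have "p dvd t * (A * (d' - 1 - A))" using eq2 by (simp add: u_def flip: eq2)
    moreover have "coprime p t" using 4(1) p by auto
    ultimately have "p dvd A * (d' - 1 - A)" by (simp add: coprime_dvd_mult_right_iff)
    then have "p dvd A * d' - A * (d' - 1 - A)" using du by (intro dvd_diff) auto
    then have "p dvd A * (A + 1)" by (simp add: algebra_simps)
    then have "p - 1 \<le> A" "p - 1 \<le> d' - 1 - A"
      using prime_dvd_mult_succ_bounds[of p A u] p(1) A du by auto
    then have "(p - 1) * ((d' - 1) - (p - 1)) \<le> A * (d' - 1 - A)"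
      by (rule mult_ge_if_sum_fixed) simp
    then have lo: "(p - 1) * (d' - p) \<le> A * (d' - 1 - A)" by simp
    have hi: "4 * (b * (d - 1 - b)) \<le> (d - 1)\<^sup>2" using four_mult_le_square[of b "d - 1 - b"] by simp
    have "4 * (t * ((p - 1) * (d' - p))) \<le> 4 * (t * (A * (d' - 1 - A)))"
      using lo 4(1) by (intro mult_left_mono) auto
    also have "\<dots> = u * (4 * (b * (d - 1 - b)))" using eq2 by simp
    also have "\<dots> \<le> u * (d - 1)\<^sup>2" using hi p3 by (intro mult_left_mono) (auto simp: u_def)
    finally have "4 * (t * ((p - 1) * (d' - p))) \<le> u * (d - 1)\<^sup>2" .
    then have "p * (4 * (t * ((p - 1) * (u - 1)))) \<le> p * ((if t = 1 then 8 else 4) * (d - 1)\<^sup>2)"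
      by (simp add: du(1) u_def algebra_simps)
    then have fin: "4 * (t * ((p - 1) * (u - 1))) \<le> (if t = 1 then 8 else 4) * (d - 1)\<^sup>2"
      using p3 by simp
    \<comment> \<open>After the substitution \<open>p = n + 3\<close> the left side minus the right
      side of \<open>fin\<close> is a polynomial in \<open>n\<close> with positive
      coefficients.\<close>
    obtain n where n: "p = n + 3" "0 \<le> n" using p3 by (metis diff_add_cancel diff_ge_0_iff_ge)
    show False
      using 4(1)
    proof
      assume "t = 1"
      then show False using fin 4(2) n by (simp add: u_def power2_eq_square algebra_simps)
        (use n in \<open>smt (verit) mult_nonneg_nonneg\<close>)
    next
      assume "t = 2"
      then show False using fin 4(2) n by (simp add: u_def power2_eq_square algebra_simps)
        (use n in \<open>smt (verit) mult_nonneg_nonneg\<close>)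
    qed
  qed
qed

text \<open>A monic quadratic in \<open>e\<close> with negative discriminant is positive everywhere;
  completing the square shows it.\<close>

lemma discriminant_contradiction:
  fixes e c t :: int
  assumes "e\<^sup>2 - t * e + c \<le> 0" "t\<^sup>2 < 4 * c"
  shows False
proof -
  have "0 \<le> (2 * e - t)\<^sup>2" by simp
  then have "0 \<le> 4 * (e\<^sup>2 - t * e) + t\<^sup>2" by (simp add: power2_eq_square algebra_simps)
  then show False using assms by simp
qed

text \<open>Both inequalities are quadratic in \<open>e\<close>. The first has negative discriminant
  if \<open>A\<close> is at most \<open>p^2 - p\<close>, the second (when \<open>h = 4\<close>) if
  \<open>d' - 1 - A\<close> is. If \<open>h = 8\<close> the first range is everything; if
  \<open>h = 4\<close> the remaining middle range violates the parameter equation.\<close>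

lemma quotient_inequalities_contradiction:
  fixes p A B e h d' b :: int
  assumes p: "prime p" "odd p" and h: "h = 4 \<or> h = 8"
    and dd: "h * p * d' = 8 * p ^ 3"
    and A: "0 < A" "A < d' - 1" and B: "p * B = A * (A + 1)"
    and eq: "d' * (b * (h * p - 1 - b)) = h * p * (A * (d' - 1 - A))"
    and e1: "(A + 1) * p - e \<le> p * e + B - e\<^sup>2"
    and e2: "3 * ((A + 1) * p - e) \<le> p * e + B - e\<^sup>2 + 2 * (p ^ 3 - 1)"
  shows False
proof -
  have p3: "3 \<le> p" using p prime_ge_2_int[of p] by (cases "p = 2") auto
  \<comment> \<open>\<open>w = 8 / h\<close>, the cofactor in \<open>d' = w p^2\<close>.\<close>
  define w where "w = (if h = 4 then 2 else 1 :: int)"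
  have d': "d' = w * p\<^sup>2"
    using dd h p3 by (auto simp: w_def power3_eq_cube power2_eq_square)
  have low: "p - 1 \<le> A" "p - 1 \<le> d' - 1 - A"
    using prime_dvd_mult_succ_bounds[of p A "w * p"] p(1) A dvd_triv_left[of p B] d'
    unfolding B by (simp_all add: power2_eq_square mult.left_commute)
  \<comment> \<open>\<open>p\<close> times the constant term of the quadratic is
    \<open>(A + 1) (p^2 - A)\<close>, whose factors have sum \<open>p^2 + 1\<close> and are both at
    least \<open>p\<close>.\<close>
  have small: False if "A \<le> p\<^sup>2 - p"
  proof (rule discriminant_contradiction)
    show "e\<^sup>2 - (p + 1) * e + ((A + 1) * p - B) \<le> 0" using e1 by (simp add: algebra_simps)
    have "p * (p\<^sup>2 + 1 - p) \<le> (A + 1) * (p\<^sup>2 - A)"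
      by (rule mult_ge_if_sum_fixed) (use low that in auto)
    also have "\<dots> = p * ((A + 1) * p - B)" using B by (simp add: power2_eq_square algebra_simps)
    finally have 1: "p\<^sup>2 + 1 - p \<le> (A + 1) * p - B" using p3 by simp
    have 2: "(p + 1)\<^sup>2 < 4 * (p\<^sup>2 + 1 - p)"
    proof -
      have "0 < 3 * (p - 1)\<^sup>2" using p3 by simp
      then show ?thesis by (simp add: power2_eq_square algebra_simps)
    qed
    show "(p + 1)\<^sup>2 < 4 * ((A + 1) * p - B)"
      by (rule order.strict_trans2[OF 2 mult_left_mono[OF 1]]) simp
  qed
  have dv: "p dvd A \<or> p dvd A + 1" using B p(1) by (metis dvd_triv_left prime_dvd_mult_iff)
  show False
  proof (cases "h = 8")
    case True
    then show False using small low d' by (simp add: w_def)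
  next
    case False
    then have d2: "d' = 2 * p\<^sup>2" "h = 4" using d' h by (auto simp: w_def)
    define A' where "A' = d' - 1 - A"
    have A': "A = 2 * p\<^sup>2 - 1 - A'" using d2 by (simp add: A'_def)
    \<comment> \<open>With \<open>c\<close> the constant term of this quadratic,
      \<open>p (c - 2 p - 2) = A' (p^2 - 1 - A')\<close>. Both factors on the right are at least
      \<open>p - 1\<close>, hence \<open>c >= (p - 1)^2 + 2 p + 2\<close>.\<close>
    have large: False if le: "A' \<le> p\<^sup>2 - p"
    proof (rule discriminant_contradiction)
      show "e\<^sup>2 - (p + 3) * e + (3 * (A + 1) * p - B - 2 * (p ^ 3 - 1)) \<le> 0"
        using e2 by (simp add: algebra_simps)
      have "(p - 1) * (p\<^sup>2 - 1 - (p - 1)) \<le> A' * (p\<^sup>2 - 1 - A')"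
        by (rule mult_ge_if_sum_fixed) (use low le in \<open>auto simp: A'_def\<close>)
      then have 1: "p * (p - 1)\<^sup>2 \<le> A' * (p\<^sup>2 - 1 - A')"
        by (simp add: power2_eq_square algebra_simps)
      have "A' * (p\<^sup>2 - 1 - A') = p * (3 * (A + 1) * p - B - 2 * (p ^ 3 - 1) - 2 * p - 2)"
      proof -
        have "p * (3 * (A + 1) * p - B - 2 * (p ^ 3 - 1) - 2 * p - 2) =
          3 * (A + 1) * p * p - A * (A + 1) - 2 * (p ^ 3 - 1) * p - 2 * p * p - 2 * p"
          using B by (simp add: algebra_simps)
        then show ?thesis
          by (simp add: A' power2_eq_square power3_eq_cube algebra_simps)
      qed
      then have 2: "(p - 1)\<^sup>2 \<le> 3 * (A + 1) * p - B - 2 * (p ^ 3 - 1) - 2 * p - 2"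
        using 1 p3 by simp
      have "0 < (p - 1)\<^sup>2" using p3 by simp
      then have 3: "(p + 3)\<^sup>2 < 4 * ((p - 1)\<^sup>2 + 2 * p + 2)"
        by (simp add: power2_eq_square algebra_simps)
      have 4: "(p - 1)\<^sup>2 + 2 * p + 2 \<le> 3 * (A + 1) * p - B - 2 * (p ^ 3 - 1)" using 2 by simp
      show "(p + 3)\<^sup>2 < 4 * (3 * (A + 1) * p - B - 2 * (p ^ 3 - 1))"
        by (rule order.strict_trans2[OF 3 mult_left_mono[OF 4]]) simp
    qed
    \<comment> \<open>With \<open>A\<close> and \<open>A'\<close> both in the middle,
      \<open>8 A A'\<close> grows like \<open>8 p^4\<close>, while the \<open>b\<close> side bounds
      it by \<open>p (4 p - 1)^2\<close>.\<close>
    have "p\<^sup>2 - p < A" "p\<^sup>2 - p < A'" using small large not_le by blast+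
    then have "(p\<^sup>2 - p) * (2 * p\<^sup>2 - 1 - (p\<^sup>2 - p)) \<le> A * A'"
      by (intro mult_ge_if_sum_fixed) (auto simp: A')
    moreover have "p * (b * (4 * p - 1 - b)) = 2 * (A * A')"
    proof -
      have "(2 * p) * (p * (b * (4 * p - 1 - b))) = (2 * p) * (2 * (A * A'))"
        using eq d2 by (simp add: A'_def power2_eq_square algebra_simps)
      then show ?thesis using p3 by (subst (asm) mult_left_cancel) auto
    qed
    moreover have "p * (4 * (b * (4 * p - 1 - b))) \<le> p * (4 * p - 1)\<^sup>2"
      using four_mult_le_square[of b "4 * p - 1 - b"] p3 by (intro mult_left_mono) auto
    ultimately have "8 * ((p\<^sup>2 - p) * (p\<^sup>2 - 1 + p)) \<le> p * (4 * p - 1)\<^sup>2"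
      by (simp add: algebra_simps)
    then have "p * (8 * ((p - 1) * (p\<^sup>2 - 1 + p))) \<le> p * (4 * p - 1)\<^sup>2"
      by (simp add: power2_eq_square algebra_simps)
    then have "8 * ((p - 1) * (p\<^sup>2 - 1 + p)) \<le> (4 * p - 1)\<^sup>2" using p3 by simp
    moreover obtain n where "p = n + 3" "0 \<le> n" using p3 by (metis diff_add_cancel diff_ge_0_iff_ge)
    ultimately show False
      by (simp add: power2_eq_square algebra_simps) (smt (verit) mult_nonneg_nonneg)
  qed
qed

section \<open>The dual group\<close>

text \<open>The domain is a parameter so that characters can be extended from a subgroup step by
  step.\<close>

definition character_on :: "('a, 'b) monoid_scheme \<Rightarrow> 'a set \<Rightarrow> ('a \<Rightarrow> complex) \<Rightarrow> bool" where
  "character_on G H c \<longleftrightarrow>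
     (\<forall>x\<in>H. c x \<noteq> 0) \<and> (\<forall>x\<in>H. \<forall>y\<in>H. c (x \<otimes>\<^bsub>G\<^esub> y) = c x * c y)"

lemma character_onD:
  assumes "character_on G H c"
  shows "x \<in> H \<Longrightarrow> c x \<noteq> 0" "x \<in> H \<Longrightarrow> y \<in> H \<Longrightarrow> c (x \<otimes>\<^bsub>G\<^esub> y) = c x * c y"
  using assms by (auto simp: character_on_def)

section \<open>Extension of characters and separation of points\<close>

context comm_group
begin

lemma character_on_one:
  assumes "subgroup H G" "character_on G H c"
  shows "c \<one> = 1"
proof -
  have "c \<one> * c \<one> = c \<one> * 1"
    using character_onD(2)[OF assms(2), of \<one> \<one>] subgroup.one_closed[OF assms(1)] by simp
  then show ?thesis
    using character_onD(1)[OF assms(2)] subgroup.one_closed[OF assms(1)] by (metis mult_cancel_left)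
qed

lemma character_on_pow:
  assumes "subgroup H G" "character_on G H c" "x \<in> H"
  shows "c (x [^] (n::nat)) = c x ^ n"
proof (induction n)
  case (Suc n)
  have "x [^] n \<in> H" using assms(1,3) by (metis subgroup_int_pow_closed int_pow_int)
  then show ?case using Suc character_onD(2)[OF assms(2)] assms(3) by simp
qed (simp add: character_on_one[OF assms(1,2)])

text \<open>The extension to the subgroup generated by \<open>H\<close> and \<open>x\<close> sends
  \<open>h x^i\<close> to \<open>c h * z^i\<close>. Here \<open>n\<close> is the order of
  \<open>x\<close> modulo \<open>H\<close>, and \<open>z\<close> may be any \<open>n\<close>-th root
  of \<open>c (x^n)\<close>; this freedom is what later separates points.\<close>

lemma extend_character_on:
  assumes fin: "finite (carrier G)" and H: "subgroup H G" and c: "character_on G H c"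
    and x: "x \<in> carrier G" and n: "0 < n" "x [^] (n::nat) \<in> H"
    and least: "\<And>i::nat. 0 < i \<Longrightarrow> i < n \<Longrightarrow> x [^] i \<notin> H"
    and z: "z ^ n = c (x [^] n)"
  obtains K c' where "subgroup K G" "H \<subseteq> K" "x \<in> K" "character_on G K c'"
    "\<And>h. h \<in> H \<Longrightarrow> c' h = c h" "c' x = z"
proof -
  have Hsub: "h \<in> carrier G" if "h \<in> H" for h using that H subgroup.subset by blast
  have H1: "\<one> \<in> H" using H subgroup.one_closed by blast
  have z0: "z \<noteq> 0"
    using z n character_onD(1)[OF c n(2)] by (metis power_0_left neq0_conv)
  \<comment> \<open>By minimality of \<open>n\<close> only multiples of \<open>n\<close> occur as
    such exponents, since the remainder \<open>t\<close> also satisfies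
    \<open>x^t \<in> H\<close>.\<close>
  have pow: "c (x [^] i) = z ^ i" if i: "x [^] i \<in> H" for i :: nat
  proof -
    define q where "q = i div n"
    define t where "t = i mod n"
    have it: "i = n * q + t" by (simp add: q_def t_def)
    have "(x [^] n) [^] q \<in> H" using n(2) H by (metis subgroup_int_pow_closed int_pow_int)
    then have "inv ((x [^] n) [^] q) \<otimes> x [^] i \<in> H"
      using i H by (simp add: subgroup.m_closed subgroup.m_inv_closed)
    moreover have "inv ((x [^] n) [^] q) \<otimes> x [^] i = x [^] t"
    proof -
      have "x [^] i = (x [^] n) [^] q \<otimes> x [^] t"
        using x by (simp add: it nat_pow_mult nat_pow_pow)
      then show ?thesis using x by (simp add: m_assoc[symmetric])
    qed
    ultimately have "x [^] t \<in> H" by simp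
    then have "t = 0" using least[of t] n(1) by (metis t_def mod_less_divisor neq0_conv)
    then have "x [^] i = (x [^] n) [^] q" using x it by (simp add: nat_pow_pow)
    then have "c (x [^] i) = (z ^ n) ^ q" using character_on_pow[OF H c n(2)] z by simp
    also have "\<dots> = z ^ i" using \<open>t = 0\<close> by (simp add: it power_mult)
    finally show ?thesis .
  qed
  \<comment> \<open>Well-definedness of the extension: two representations differ by the power
    \<open>x^(j - i)\<close>, which lies in \<open>H\<close>. The order \<open>i \<le> j\<close>
    keeps the exponent natural.\<close>
  have wd_le: "c h * z ^ i = c h' * z ^ j"
    if "h \<in> H" "h' \<in> H" "h \<otimes> x [^] i = h' \<otimes> x [^] j" "i \<le> j" for h h' and i j :: nat
  proof -
    have "h \<otimes> x [^] i = h' \<otimes> x [^] (j - i) \<otimes> x [^] i"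
      using that x Hsub by (simp add: m_assoc nat_pow_mult)
    then have h: "h = h' \<otimes> x [^] (j - i)" using that x Hsub by simp
    then have "inv h' \<otimes> h = x [^] (j - i)" using that x Hsub by (simp add: m_assoc[symmetric])
    moreover have "inv h' \<otimes> h \<in> H" using that H by (simp add: subgroup.m_closed subgroup.m_inv_closed)
    ultimately have *: "x [^] (j - i) \<in> H" by simp
    then have "c h = c h' * z ^ (j - i)" using h character_onD(2)[OF c that(2) *] pow by simp
    then show ?thesis using that(4) by (simp add: mult.assoc flip: power_add)
  qed
  have wd: "c h * z ^ i = c h' * z ^ j"
    if "h \<in> H" "h' \<in> H" "h \<otimes> x [^] i = h' \<otimes> x [^] j" for h h' and i j :: nat
    using wd_le[of h h' i j] wd_le[of h' h j i] that by (metis linear)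
  define K where "K = {h \<otimes> x [^] i | h i. h \<in> H \<and> i \<in> (UNIV :: nat set)}"
  define c' where "c' y = (THE w. \<exists>h\<in>H. \<exists>i::nat. y = h \<otimes> x [^] i \<and> w = c h * z ^ i)" for y
  have c': "c' (h \<otimes> x [^] i) = c h * z ^ i" if "h \<in> H" for h and i :: nat
    unfolding c'_def
  proof (rule the_equality)
    fix w assume "\<exists>h'\<in>H. \<exists>j. h \<otimes> x [^] i = h' \<otimes> x [^] j \<and> w = c h' * z ^ j"
    then show "w = c h * z ^ i" using wd[OF that] by auto
  qed (use that in blast)
  have KI: "h \<otimes> x [^] i \<in> K" if "h \<in> H" for h and i :: nat using that by (auto simp: K_def)
  have mult: "(h \<otimes> x [^] i) \<otimes> (h' \<otimes> x [^] j) = (h \<otimes> h') \<otimes> x [^] (i + j)"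
    if "h \<in> H" "h' \<in> H" for h h' and i j :: nat
    using that Hsub x by (simp add: nat_pow_mult[symmetric] m_ac)
  have ord: "0 < order G" using fin order_gt_0_iff_finite by blast
  \<comment> \<open>In a finite group the inverse is a natural power, so \<open>K\<close>, built
    with natural exponents only, is closed under inverses.\<close>
  have inv_x: "inv x = x [^] (order G - 1)"
  proof (rule inv_equality)
    have "x [^] (order G - 1) \<otimes> x = x [^] Suc (order G - 1)" by simp
    also have "\<dots> = \<one>" using ord x pow_order_eq_1[OF x] by simp
    finally show "x [^] (order G - 1) \<otimes> x = \<one>" .
  qed (use x in auto)
  have "subgroup K G"
  proof (rule subgroupI)
    show "K \<subseteq> carrier G" using Hsub x by (auto simp: K_def)
    show "K \<noteq> {}" using H1 by (auto simp: K_def)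
  next
    fix a assume "a \<in> K"
    then obtain h and i :: nat where a: "h \<in> H" "a = h \<otimes> x [^] i" by (auto simp: K_def)
    have "inv a = inv h \<otimes> inv (x [^] i)" using a Hsub x by (simp add: inv_mult)
    also have "inv (x [^] i) = (inv x) [^] i" using x by (simp add: nat_pow_inv)
    also have "\<dots> = x [^] ((order G - 1) * i)" unfolding inv_x using x by (simp add: nat_pow_pow)
    finally show "inv a \<in> K" using KI subgroup.m_inv_closed[OF H a(1)] by simp
  next
    fix a a' assume "a \<in> K" "a' \<in> K"
    then show "a \<otimes> a' \<in> K" using mult KI subgroup.m_closed[OF H] by (fastforce simp: K_def)
  qed
  moreover have "H \<subseteq> K" using KI[of _ 0] Hsub by fastforce
  moreover have xK: "\<one> \<otimes> x [^] (1::nat) = x" using x by simp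
  then have "x \<in> K" using KI[OF H1, of 1] by simp
  moreover have "character_on G K c'"
    unfolding character_on_def
  proof (intro conjI ballI)
    fix a assume "a \<in> K"
    then obtain h and i :: nat where "h \<in> H" "a = h \<otimes> x [^] i" by (auto simp: K_def)
    then show "c' a \<noteq> 0" using c' z0 character_onD(1)[OF c] by simp
  next
    fix a a' assume "a \<in> K" "a' \<in> K"
    then obtain h h' and i j :: nat where
      a: "h \<in> H" "a = h \<otimes> x [^] i" "h' \<in> H" "a' = h' \<otimes> x [^] j"
      unfolding K_def by blast
    then have "c' (a \<otimes> a') = c (h \<otimes> h') * z ^ (i + j)"
      using mult c' subgroup.m_closed[OF H] by simp
    then show "c' (a \<otimes> a') = c' a * c' a'"
      using a c' character_onD(2)[OF c] by (simp add: power_add)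
  qed
  moreover have "c' h = c h" if "h \<in> H" for h using c'[OF that, of 0] that Hsub by simp
  moreover have "c' x = z" using c'[OF H1, of 1] xK character_on_one[OF H c] by simp
  ultimately show thesis using that by blast
qed

lemma least_pow_in_subgroup:
  assumes "finite (carrier G)" "subgroup H G" "x \<in> carrier G"
  obtains n :: nat where "0 < n" "x [^] n \<in> H" "\<And>i::nat. 0 < i \<Longrightarrow> i < n \<Longrightarrow> x [^] i \<notin> H"
proof -
  let ?P = "\<lambda>n::nat. 0 < n \<and> x [^] n \<in> H"
  have "?P (order G)"
    using assms pow_order_eq_1 subgroup.one_closed order_gt_0_iff_finite by auto
  then have "?P (LEAST n. ?P n)" by (rule LeastI)
  then show thesis using that[of "LEAST n. ?P n"] not_less_Least[of _ ?P] by blast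
qed

text \<open>Among the subgroups that contain \<open>g\<close> and carry a character nontrivial at
  \<open>g\<close>, a maximal one must be the whole group, because a character extends by any
  further element.\<close>

lemma separating_character:
  assumes fin: "finite (carrier G)" and g: "g \<in> carrier G" "g \<noteq> \<one>"
  obtains c where "character_on G (carrier G) c" "c g \<noteq> 1"
proof -
  define S where "S = {H. subgroup H G \<and> g \<in> H \<and> (\<exists>c. character_on G H c \<and> c g \<noteq> 1)}"
  \<comment> \<open>The trivial character of \<open>{\<one>}\<close> is extended to
    \<open>g\<close>. Its order \<open>n\<close> is not 1, so there is an \<open>n\<close>-th root
    of unity \<open>z\<close> other than 1 to serve as the value at \<open>g\<close>.\<close>
  have "S \<noteq> {}"
  proof -
    have H: "subgroup {\<one>} G" by (rule triv_subgroup)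
    have c: "character_on G {\<one>} (\<lambda>_. 1)" by (simp add: character_on_def)
    obtain n :: nat where n: "0 < n" "g [^] n \<in> {\<one>}"
      "\<And>i::nat. 0 < i \<Longrightarrow> i < n \<Longrightarrow> g [^] i \<notin> {\<one>}"
      using least_pow_in_subgroup[OF fin H g(1)] by metis
    have "n \<noteq> 1" using n(2) g by auto
    then have "card {z::complex. z ^ n = 1} > 1" using card_nth_roots[of 1 n] n(1) by simp
    then have "\<not> {z::complex. z ^ n = 1} \<subseteq> {1}" using card_mono[of "{1}" "{z::complex. z ^ n = 1}"] by auto
    then obtain z :: complex where z: "z ^ n = 1" "z \<noteq> 1" by blast
    obtain K c' where "subgroup K G" "g \<in> K" "character_on G K c'" "c' g = z"
      using extend_character_on[OF fin H c g(1) n z(1)] by metis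
    then show ?thesis using z(2) unfolding S_def by blast
  qed
  moreover have "finite S"
    by (rule finite_subset[of _ "Pow (carrier G)"]) (use fin subgroup.subset in \<open>auto simp: S_def\<close>)
  ultimately obtain H where H: "H \<in> S" "\<And>K. K \<in> S \<Longrightarrow> \<not> H \<subset> K"
    using finite_has_maximal[of S] by (metis psubset_eq)
  then obtain c where Hc: "subgroup H G" "g \<in> H" "character_on G H c" "c g \<noteq> 1"
    unfolding S_def by blast
  have "carrier G \<subseteq> H"
  proof
    fix x assume x: "x \<in> carrier G"
    obtain n :: nat where n: "0 < n" "x [^] n \<in> H"
      "\<And>i::nat. 0 < i \<Longrightarrow> i < n \<Longrightarrow> x [^] i \<notin> H"
      using least_pow_in_subgroup[OF fin Hc(1) x] by metis
    have card: "card {z. z ^ n = c (x [^] n)} = n"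
      using card_nth_roots n(1) character_onD(1)[OF Hc(3) n(2)] by blast
    have "{z. z ^ n = c (x [^] n)} \<noteq> {}"
    proof
      assume empty: "{z. z ^ n = c (x [^] n)} = {}"
      show False using card n(1) unfolding empty by simp
    qed
    then obtain z where z: "z ^ n = c (x [^] n)" by blast
    obtain K c' where K: "subgroup K G" "H \<subseteq> K" "x \<in> K" "character_on G K c'"
      "\<And>h. h \<in> H \<Longrightarrow> c' h = c h"
      using extend_character_on[OF fin Hc(1,3) x n z] by metis
    then have "K \<in> S" unfolding S_def using Hc(2,4) by (metis (mono_tags, lifting) mem_Collect_eq subsetD)
    then show "x \<in> H" using H(2)[of K] K(2,3) by blast
  qed
  then have "H = carrier G" using subgroup.subset[OF Hc(1)] by blast
  then show thesis using that Hc by blast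
qed

end

text \<open>Extensionality gives each character exactly one representing function, so that equality
  and counting in the dual are meaningful.\<close>

definition dual_group :: "('a, 'b) monoid_scheme \<Rightarrow> ('a \<Rightarrow> complex) monoid" where
  "dual_group G = \<lparr>carrier = {c. c \<in> extensional (carrier G) \<and> character_on G (carrier G) c},
     monoid.mult = (\<lambda>c d. restrict (\<lambda>x. c x * d x) (carrier G)),
     one = restrict (\<lambda>_. 1) (carrier G)\<rparr>"

lemma dual_group_mult_apply:
  "x \<in> carrier G \<Longrightarrow> (c \<otimes>\<^bsub>dual_group G\<^esub> d) x = c x * d x"
  by (simp add: dual_group_def)

lemma dual_group_one_apply: "x \<in> carrier G \<Longrightarrow> \<one>\<^bsub>dual_group G\<^esub> x = 1"
  by (simp add: dual_group_def)

lemma dual_group_carrierD: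
  assumes "c \<in> carrier (dual_group G)"
  shows "c \<in> extensional (carrier G)" "character_on G (carrier G) c"
  using assms by (auto simp: dual_group_def)

lemma comm_group_dual_group:
  assumes "group G"
  shows "comm_group (dual_group G)"
proof (rule comm_groupI)
  interpret group G by fact
  show "\<one>\<^bsub>dual_group G\<^esub> \<in> carrier (dual_group G)"
    by (auto simp: dual_group_def character_on_def)
  fix c assume c: "c \<in> carrier (dual_group G)"
  then have c': "character_on G (carrier G) c" and ext: "c \<in> extensional (carrier G)"
    by (auto simp: dual_group_def)
  show "\<one>\<^bsub>dual_group G\<^esub> \<otimes>\<^bsub>dual_group G\<^esub> c = c"
    using ext by (intro extensionalityI[of _ "carrier G"]) (auto simp: dual_group_def)
  show "\<exists>d\<in>carrier (dual_group G). d \<otimes>\<^bsub>dual_group G\<^esub> c = \<one>\<^bsub>dual_group G\<^esub>"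
  proof (rule bexI[of _ "restrict (\<lambda>x. inverse (c x)) (carrier G)"])
    show "restrict (\<lambda>x. inverse (c x)) (carrier G) \<in> carrier (dual_group G)"
      using c' by (auto simp: dual_group_def character_on_def)
    show "restrict (\<lambda>x. inverse (c x)) (carrier G) \<otimes>\<^bsub>dual_group G\<^esub> c = \<one>\<^bsub>dual_group G\<^esub>"
      using c' by (auto simp: dual_group_def character_on_def intro!: restrict_ext)
  qed
  fix d assume d: "d \<in> carrier (dual_group G)"
  show "c \<otimes>\<^bsub>dual_group G\<^esub> d \<in> carrier (dual_group G)"
    using c d by (auto simp: dual_group_def character_on_def)
  show "c \<otimes>\<^bsub>dual_group G\<^esub> d = d \<otimes>\<^bsub>dual_group G\<^esub> c"
    by (simp add: dual_group_def mult.commute)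
  fix e assume "e \<in> carrier (dual_group G)"
  show "c \<otimes>\<^bsub>dual_group G\<^esub> d \<otimes>\<^bsub>dual_group G\<^esub> e = c \<otimes>\<^bsub>dual_group G\<^esub> (d \<otimes>\<^bsub>dual_group G\<^esub> e)"
    by (auto simp: dual_group_def mult.assoc intro!: restrict_ext)
qed

section \<open>Finiteness and orthogonality relations\<close>

context comm_group
begin

abbreviation "dual \<equiv> dual_group G"

lemma dual_mult: "c \<in> carrier dual \<Longrightarrow> x \<in> carrier G \<Longrightarrow> y \<in> carrier G \<Longrightarrow> c (x \<otimes> y) = c x * c y"
  using dual_group_carrierD(2) character_onD(2) by metis

lemma dual_at_one: "c \<in> carrier dual \<Longrightarrow> c \<one> = 1"
  using dual_group_carrierD(2) character_on_one[OF subgroup_self] by blast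

lemma dual_inv_apply:
  assumes "c \<in> carrier dual" "x \<in> carrier G"
  shows "(inv\<^bsub>dual\<^esub> c) x = c (inv x)"
proof -
  interpret D: comm_group dual by (rule comm_group_dual_group) unfold_locales
  have "(inv\<^bsub>dual\<^esub> c \<otimes>\<^bsub>dual\<^esub> c) x = 1" using assms by (simp add: dual_group_one_apply)
  then have "(inv\<^bsub>dual\<^esub> c) x * c x = 1" by (simp only: dual_group_mult_apply[OF assms(2)])
  moreover have "c (inv x) * c x = 1"
    using assms dual_mult[of c "inv x" x] dual_at_one[OF assms(1)] by simp
  ultimately show ?thesis by (metis mult.assoc mult.commute mult_1)
qed

text \<open>All values are roots of unity of exponent \<open>order G\<close>, which leaves finitely
  many extensional functions.\<close>

lemma finite_dual:
  assumes fin: "finite (carrier G)"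
  shows "finite (carrier dual)"
proof (rule finite_subset)
  show "carrier dual \<subseteq> PiE (carrier G) (\<lambda>_. {z. z ^ order G = 1})"
  proof
    fix c assume c: "c \<in> carrier dual"
    have "c x ^ order G = 1" if "x \<in> carrier G" for x
      using character_on_pow[OF subgroup_self dual_group_carrierD(2)[OF c] that, of "order G"]
        that dual_at_one[OF c] by (simp add: pow_order_eq_1)
    then show "c \<in> PiE (carrier G) (\<lambda>_. {z. z ^ order G = 1})"
      using dual_group_carrierD(1)[OF c] by (auto simp: PiE_def)
  qed
  show "finite (PiE (carrier G) (\<lambda>_. {z::complex. z ^ order G = 1}))"
    using fin order_gt_0_iff_finite by (intro finite_PiE finite_nth_roots) auto
qed

text \<open>Translation by an element \<open>a\<close> with \<open>c a \<noteq> 1\<close> preserves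
  the sum and multiplies it by \<open>c a\<close>, so the sum vanishes.\<close>

lemma sum_dual_apply:
  assumes fin: "finite (carrier G)" and c: "c \<in> carrier dual"
  shows "(\<Sum>x\<in>carrier G. c x) = (if c = \<one>\<^bsub>dual\<^esub> then of_nat (order G) else 0)"
proof (cases "c = \<one>\<^bsub>dual\<^esub>")
  case True
  then show ?thesis by (simp add: dual_group_one_apply order_def)
next
  case False
  have "\<exists>a\<in>carrier G. c a \<noteq> 1"
  proof (rule ccontr)
    assume "\<not> ?thesis"
    then have "c = \<one>\<^bsub>dual\<^esub>"
      using dual_group_carrierD(1)[OF c] by (intro extensionalityI[of _ "carrier G"]) (auto simp: dual_group_def)
    with False show False by simp
  qed
  then obtain a where a: "a \<in> carrier G" "c a \<noteq> 1" by blast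
  have "(\<Sum>x\<in>carrier G. c x) = (\<Sum>x\<in>carrier G. c (a \<otimes> x))"
    by (rule sum_translate[OF a(1), symmetric])
  also have "\<dots> = c a * (\<Sum>x\<in>carrier G. c x)"
    using a by (simp add: dual_mult[OF c] sum_distrib_left)
  finally show ?thesis using a(2) False by simp
qed

text \<open>The same translation argument in the dual, using a character nontrivial at
  \<open>g\<close>. It is stated with \<open>order dual\<close>, whose value is computed from it
  next.\<close>

lemma sum_over_dual_aux:
  assumes fin: "finite (carrier G)" and g: "g \<in> carrier G"
  shows "(\<Sum>c\<in>carrier dual. c g) = (if g = \<one> then of_nat (order dual) else 0)"
proof (cases "g = \<one>")
  case True
  then show ?thesis by (simp add: dual_at_one order_def)
next
  case False
  interpret D: comm_group dual by (rule comm_group_dual_group) unfold_locales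
  obtain a where a: "character_on G (carrier G) a" "a g \<noteq> 1"
    using separating_character[OF fin g False] by blast
  define b where "b = restrict a (carrier G)"
  have b: "b \<in> carrier dual" "b g \<noteq> 1"
    using a g by (auto simp: b_def dual_group_def character_on_def)
  have "(\<Sum>c\<in>carrier dual. c g) = (\<Sum>c\<in>carrier dual. (b \<otimes>\<^bsub>dual\<^esub> c) g)"
    by (rule D.sum_translate[OF b(1), where f = "\<lambda>c. c g", symmetric])
  also have "\<dots> = b g * (\<Sum>c\<in>carrier dual. c g)"
    using g by (simp add: dual_group_mult_apply sum_distrib_left)
  finally show ?thesis using b(2) False by simp
qed

text \<open>Both orders equal the double sum of \<open>c x\<close> over all characters and elements,
  evaluated in the two orders of summation.\<close>

lemma order_dual:
  assumes fin: "finite (carrier G)"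
  shows "order dual = order G"
proof -
  interpret D: comm_group dual by (rule comm_group_dual_group) unfold_locales
  have "of_nat (order G) = (\<Sum>c\<in>carrier dual. \<Sum>x\<in>carrier G. c x)"
    using finite_dual[OF fin] by (simp add: sum_dual_apply[OF fin] sum.delta')
  also have "\<dots> = (\<Sum>x\<in>carrier G. \<Sum>c\<in>carrier dual. c x)" by (rule sum.swap)
  also have "\<dots> = of_nat (order dual)"
    using fin by (simp add: sum_over_dual_aux[OF fin] sum.delta')
  finally show ?thesis by simp
qed

lemma sum_over_dual:
  assumes "finite (carrier G)" "g \<in> carrier G"
  shows "(\<Sum>c\<in>carrier dual. c g) = (if g = \<one> then of_nat (order G) else 0)"
  using sum_over_dual_aux[OF assms] order_dual[OF assms(1)] by simp

end

section \<open>The dual partial difference set\<close>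

text \<open>A rational number whose powers have a common denominator \<open>C\<close> is an integer:
  every power of its reduced denominator \<open>b'\<close> divides \<open>C\<close>. This replaces
  an appeal to algebraic integers.\<close>

lemma dvd_if_power_dvd_multiple:
  fixes a b C :: int
  assumes "C \<noteq> 0" "b \<noteq> 0" "\<And>j. b ^ j dvd C * a ^ j"
  shows "b dvd a"
proof -
  define g where "g = gcd a b"
  have g0: "g \<noteq> 0" using assms(2) by (simp add: g_def)
  obtain a' b' where ab: "a = a' * g" "b = b' * g" "coprime a' b'"
    using gcd_coprime_exists[of a b] g0 unfolding g_def by blast
  have dv: "b' ^ j dvd C" for j
  proof -
    have "b' ^ j * g ^ j dvd (C * a' ^ j) * g ^ j"
      using assms(3)[of j] ab by (simp add: power_mult_distrib mult.assoc)
    then have "b' ^ j dvd C * a' ^ j" using g0 by simp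
    moreover have "coprime (b' ^ j) (a' ^ j)" using ab(3) by (simp add: coprime_commute)
    ultimately show ?thesis using coprime_dvd_mult_left_iff by blast
  qed
  have "\<bar>b'\<bar> \<le> 1"
  proof (rule ccontr)
    assume "\<not> ?thesis"
    then have b2: "2 \<le> \<bar>b'\<bar>" by simp
    have "2 ^ nat \<bar>C\<bar> \<le> \<bar>b'\<bar> ^ nat \<bar>C\<bar>" using b2 by (intro power_mono) auto
    also have "\<dots> \<le> \<bar>C\<bar>" using dvd_imp_le_int[OF assms(1) dv[of "nat \<bar>C\<bar>"]] by (simp add: power_abs)
    finally have "(2::int) ^ nat \<bar>C\<bar> \<le> int (nat \<bar>C\<bar>)" by simp
    moreover have "int (nat \<bar>C\<bar>) < 2 ^ nat \<bar>C\<bar>" using of_nat_less_two_power by blast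
    ultimately show False by simp
  qed
  moreover have "b' \<noteq> 0" using assms(2) ab by auto
  ultimately have "b' = 1 \<or> b' = -1" by auto
  then show ?thesis using ab by auto
qed

text \<open>Inversion pairs off the elements that are not self-inverse, so the self-inverse ones are
  even in number and include more than the identity.\<close>

lemma (in comm_group) even_order_involution:
  assumes fin: "finite (carrier G)" and "even (order G)"
  obtains x where "x \<in> carrier G" "x \<noteq> \<one>" "x \<otimes> x = \<one>"
proof -
  define X where "X = {x \<in> carrier G. inv x \<noteq> x}"
  have "even (\<Sum>x\<in>X. 1::int)"
    by (rule even_sum_involution[where h = "\<lambda>x. inv x"]) (use fin in \<open>auto simp: X_def\<close>)
  then have "even (card X)" by simp
  moreover have "card (carrier G - X) = card (carrier G) - card X"
    using fin by (intro card_Diff_subset) (auto simp: X_def)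
  moreover have "card X \<le> card (carrier G)" using fin by (intro card_mono) (auto simp: X_def)
  ultimately have "even (card (carrier G - X))" using assms(2) by (simp add: order_def)
  then have "carrier G - X \<noteq> {\<one>}" by auto
  moreover have "\<one> \<in> carrier G - X" by (simp add: X_def)
  ultimately obtain x where "x \<in> carrier G" "x \<noteq> \<one>" "inv x = x" unfolding X_def by blast
  then show thesis using that r_inv by metis
qed

section \<open>Character sums, counting identities and Fourier coefficients\<close>

context comm_group
begin

lemma sum_indicator:
  fixes f :: "'a \<Rightarrow> 'c::comm_ring_1"
  assumes "finite (carrier G)" "D \<subseteq> carrier G"
  shows "(\<Sum>x\<in>carrier G. of_bool (x \<in> D) * f x) = (\<Sum>x\<in>D. f x)"
proof -
  have "(\<Sum>x\<in>carrier G. of_bool (x \<in> D) * f x) = (\<Sum>x\<in>D. of_bool (x \<in> D) * f x)"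
    by (rule sum.mono_neutral_right) (use assms in auto)
  then show ?thesis by simp
qed

lemma gconv_indicator:
  assumes "finite (carrier G)" "D \<subseteq> carrier G"
  shows "gconv G (\<lambda>x. of_bool (x \<in> D)) (\<lambda>x. of_bool (x \<in> D)) z = int (card {x \<in> D. inv x \<otimes> z \<in> D})"
proof -
  have "gconv G (\<lambda>x. of_bool (x \<in> D)) (\<lambda>x. of_bool (x \<in> D)) z = (\<Sum>x\<in>D. of_bool (inv x \<otimes> z \<in> D))"
    unfolding gconv_def by (rule sum_indicator[OF assms])
  also have "\<dots> = int (card {x \<in> D. inv x \<otimes> z \<in> D})"
    using finite_subset[OF assms(2,1)] by (simp add: Int_def)
  finally show ?thesis .
qed

text \<open>A nontrivial character is applied to the quadratic equation; it annihilates the multiple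
  \<open>m\<close> of the whole group.\<close>

lemma dual_sum_square:
  assumes fin: "finite (carrier G)" and D: "D \<subseteq> carrier G" and c: "c \<in> carrier dual"
    and eq: "\<And>z. z \<in> carrier G \<Longrightarrow>
      gconv G (\<lambda>x. of_bool (x \<in> D)) (\<lambda>x. of_bool (x \<in> D)) z =
        a * of_bool (z = \<one>) + b * of_bool (z \<in> D) + m"
    and c1: "c \<noteq> \<one>\<^bsub>dual\<^esub>"
  shows "(\<Sum>x\<in>D. c x)\<^sup>2 = of_int a + of_int b * (\<Sum>x\<in>D. c x)"
proof -
  let ?u = "\<lambda>x. of_bool (x \<in> D) :: int"
  have "(\<Sum>x\<in>D. c x)\<^sup>2 = (\<Sum>z\<in>carrier G. of_int (gconv G ?u ?u z) * c z)"
    using sum_gconv_mult[of c ?u ?u] dual_mult[OF c] sum_indicator[OF fin D, of c]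
    by (simp add: power2_eq_square)
  also have "\<dots> = (\<Sum>z\<in>carrier G. (if z = \<one> then of_int a * c z else 0)
      + of_int b * (of_bool (z \<in> D) * c z) + of_int m * c z)"
    by (intro sum.cong refl) (simp add: eq algebra_simps)
  also have "\<dots> = of_int a + of_int b * (\<Sum>x\<in>D. c x)"
    using fin c1 by (simp add: sum.distrib sum_distrib_left[symmetric] sum_indicator[OF fin D]
        sum_dual_apply[OF fin c] dual_at_one[OF c])
  finally show ?thesis .
qed

text \<open>The first identity is the coefficient at the identity element, the second the image of
  the equation under the augmentation.\<close>

lemma pds_equation_counts:
  assumes fin: "finite (carrier G)" and D: "pds_equation G D r s m"
  shows "int (card D) = m - r * s"
    "(int (card D) - r) * (int (card D) - s) = m * int (order G)"
proof -
  let ?u = "\<lambda>x. of_bool (x \<in> D) :: int"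
  have Dsub: "D \<subseteq> carrier G" and D1: "\<one> \<notin> D" and Dinv: "\<And>x. x \<in> D \<Longrightarrow> inv x \<in> D"
    and eq: "\<And>z. z \<in> carrier G \<Longrightarrow> gconv G ?u ?u z =
      - (r * s) * of_bool (z = \<one>) + (r + s) * of_bool (z \<in> D) + m"
    using D by (auto simp: pds_equation_def)
  have "{x \<in> D. inv x \<otimes> \<one> \<in> D} = D" using Dsub Dinv by auto
  then have "gconv G ?u ?u \<one> = int (card D)" using gconv_indicator[OF fin Dsub, of \<one>] by simp
  then show k: "int (card D) = m - r * s" using eq[of \<one>] D1 by simp
  have su: "sum ?u (carrier G) = int (card D)" using sum_indicator[OF fin Dsub, of "\<lambda>_. 1::int"] by simp
  have "int (card D) * int (card D) = (\<Sum>z\<in>carrier G. gconv G ?u ?u z)"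
    unfolding sum_gconv su ..
  also have "\<dots> = (\<Sum>z\<in>carrier G. (if z = \<one> then - (r * s) else 0) + (r + s) * ?u z + m)"
    by (intro sum.cong refl) (simp add: eq)
  also have "\<dots> = - (r * s) + (r + s) * int (card D) + m * int (order G)"
    using fin su by (simp add: sum.distrib sum_distrib_left[symmetric] order_def)
  finally show "(int (card D) - r) * (int (card D) - s) = m * int (order G)"
    by (simp add: algebra_simps)
qed

text \<open>The witness \<open>w\<close> is the coefficient function of the power \<open>E^j\<close>
  in the group ring of the dual; evaluation at \<open>g\<close> is multiplicative.\<close>

lemma dual_sum_power:
  assumes fin: "finite (carrier G)" and E: "E \<subseteq> carrier dual"
  shows "\<exists>w::('a \<Rightarrow> complex) \<Rightarrow> int. \<forall>g\<in>carrier G. (\<Sum>c\<in>E. c g) ^ j = (\<Sum>c\<in>carrier dual. of_int (w c) * c g)"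
proof (induction j)
  case 0
  interpret D: comm_group dual by (rule comm_group_dual_group) unfold_locales
  have "(\<Sum>c\<in>carrier dual. of_int (of_bool (c = \<one>\<^bsub>dual\<^esub>)) * c g) = 1" if "g \<in> carrier G" for g
  proof -
    have "(\<Sum>c\<in>carrier dual. of_int (of_bool (c = \<one>\<^bsub>dual\<^esub>)) * c g) =
        (\<Sum>c\<in>carrier dual. if c = \<one>\<^bsub>dual\<^esub> then c g else 0)"
      by (intro sum.cong) auto
    then show ?thesis using finite_dual[OF fin] that by (simp add: dual_group_one_apply)
  qed
  then show ?case by (intro exI[of _ "\<lambda>c. of_bool (c = \<one>\<^bsub>dual\<^esub>)"]) simp
next
  case (Suc j)
  interpret D: comm_group dual by (rule comm_group_dual_group) unfold_locales
  obtain w :: "('a \<Rightarrow> complex) \<Rightarrow> int"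
    where w: "\<And>g. g \<in> carrier G \<Longrightarrow> (\<Sum>c\<in>E. c g) ^ j = (\<Sum>c\<in>carrier dual. of_int (w c) * c g)"
    using Suc by blast
  let ?e = "\<lambda>c. of_bool (c \<in> E) :: int"
  have "(\<Sum>c\<in>E. c g) ^ Suc j = (\<Sum>c\<in>carrier dual. of_int (gconv dual ?e w c) * c g)"
    if g: "g \<in> carrier G" for g
  proof -
    have "(\<Sum>c\<in>carrier dual. of_int (?e c) * c g) = (\<Sum>c\<in>E. c g)"
      using D.sum_indicator[OF finite_dual[OF fin] E, of "\<lambda>c. c g"] by simp
    then show ?thesis
      using D.sum_gconv_mult[of "\<lambda>c. c g" ?e w] w[OF g] g by (simp add: dual_group_mult_apply)
  qed
  then show ?case by blast
qed

text \<open>Fourier inversion. By orthogonality only the coefficient at the inverse of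
  \<open>a\<close> survives, so the sum is an integer, as the integrality argument for the dual
  requires.\<close>

lemma dual_fourier_coefficient:
  fixes w :: "('a \<Rightarrow> complex) \<Rightarrow> int"
  assumes fin: "finite (carrier G)" and a: "a \<in> carrier dual"
  shows "(\<Sum>g\<in>carrier G. (\<Sum>c\<in>carrier dual. of_int (w c) * c g) * a g) =
    of_int (int (order G) * w (inv\<^bsub>dual\<^esub> a))"
proof -
  interpret D: comm_group dual by (rule comm_group_dual_group) unfold_locales
  have "(\<Sum>g\<in>carrier G. (\<Sum>c\<in>carrier dual. of_int (w c) * c g) * a g) =
      (\<Sum>c\<in>carrier dual. of_int (w c) * (\<Sum>g\<in>carrier G. (c \<otimes>\<^bsub>dual\<^esub> a) g))"
    by (subst sum_distrib_right, subst sum.swap)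
      (simp add: dual_group_mult_apply sum_distrib_left mult.assoc)
  also have "\<dots> = (\<Sum>c\<in>carrier dual. if c = inv\<^bsub>dual\<^esub> a then of_int (w c) * of_nat (order G) else 0)"
  proof (rule sum.cong[OF refl])
    fix c assume c: "c \<in> carrier dual"
    have "c \<otimes>\<^bsub>dual\<^esub> a = \<one>\<^bsub>dual\<^esub> \<longleftrightarrow> c = inv\<^bsub>dual\<^esub> a"
      using a c D.inv_equality D.l_inv by metis
    then show "of_int (w c) * (\<Sum>g\<in>carrier G. (c \<otimes>\<^bsub>dual\<^esub> a) g) =
        (if c = inv\<^bsub>dual\<^esub> a then of_int (w c) * of_nat (order G) else 0)"
      using sum_dual_apply[OF fin, of "c \<otimes>\<^bsub>dual\<^esub> a"] a c by simp
  qed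
  also have "\<dots> = of_int (int (order G) * w (inv\<^bsub>dual\<^esub> a))"
    using finite_dual[OF fin] a by simp
  finally show ?thesis .
qed

text \<open>\<open>D'\<close> consists of the nontrivial characters with value \<open>r\<close> on
  \<open>D\<close>. The Fourier transform of its indicator takes two values off the identity; their
  integrality gives the divisibilities and Fourier inversion the equation. The dual exchanges
  \<open>r - s\<close> with \<open>d'\<close> and \<open>- s\<close> with
  \<open>A + 1\<close>.\<close>

lemma dual_partial_difference_set:
  assumes fin: "finite (carrier G)" and D: "pds_equation G D r s m"
    and r: "0 < r" and s: "s < 0" and k: "card D + 1 < order G"
  obtains d' A m' :: int and D' where
    "(r - s) * d' = int (order G)" "int (card D) - s = (r - s) * (A + 1)"
    "pds_equation dual D' (d' - (A + 1)) (- (A + 1)) m'" "int (card D') + (A + 1) = d' * (- s)"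
proof -
  interpret D: comm_group dual by (rule comm_group_dual_group) unfold_locales
  have finD: "finite (carrier dual)" by (rule finite_dual[OF fin])
  let ?u = "\<lambda>x. of_bool (x \<in> D) :: int"
  have Dsub: "D \<subseteq> carrier G" and D1: "\<one> \<notin> D" and Dinv: "\<And>x. x \<in> D \<Longrightarrow> inv x \<in> D"
    and eq: "\<And>z. z \<in> carrier G \<Longrightarrow> gconv G ?u ?u z =
      - (r * s) * of_bool (z = \<one>) + (r + s) * of_bool (z \<in> D) + m"
    using D by (auto simp: pds_equation_def)
  define n where "n = int (order G)"
  define k where "k = int (card D)"
  define d where "d = r - s"
  have d0: "0 < d" using r s by (simp add: d_def)
  define S where "S c = (\<Sum>x\<in>D. c x)" for c :: "'a \<Rightarrow> complex"
  define D' where "D' = {c \<in> carrier dual. c \<noteq> \<one>\<^bsub>dual\<^esub> \<and> S c = of_int r}"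
  have D'sub: "D' \<subseteq> carrier dual" by (auto simp: D'_def)
  have S1: "S \<one>\<^bsub>dual\<^esub> = of_int k"
  proof -
    have "S \<one>\<^bsub>dual\<^esub> = (\<Sum>x\<in>D. 1)" unfolding S_def
      by (intro sum.cong refl) (use Dsub in \<open>auto simp: dual_group_one_apply\<close>)
    then show ?thesis by (simp add: k_def)
  qed
  have Srs: "S c = of_int r \<or> S c = of_int s" if "c \<in> carrier dual" "c \<noteq> \<one>\<^bsub>dual\<^esub>" for c
  proof -
    have "(S c)\<^sup>2 = of_int (- (r * s)) + of_int (r + s) * S c"
      unfolding S_def by (rule dual_sum_square[OF fin Dsub that(1) eq that(2)])
    then have "(S c - of_int r) * (S c - of_int s) = 0"
      by (simp add: power2_eq_square algebra_simps)
    then show ?thesis by simp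
  qed
  have S_eq: "S c = of_int (s + d * of_bool (c \<in> D') + (k - s) * of_bool (c = \<one>\<^bsub>dual\<^esub>))"
    if "c \<in> carrier dual" for c
    using that Srs[OF that] S1 by (auto simp: D'_def d_def)
  have S_inv: "S (inv\<^bsub>dual\<^esub> c) = S c" if c: "c \<in> carrier dual" for c
    unfolding S_def
    by (rule sum.reindex_bij_witness[of _ "\<lambda>x. inv x" "\<lambda>x. inv x"])
      (use c Dsub Dinv in \<open>auto simp: dual_inv_apply subset_iff\<close>)
  define \<phi> where "\<phi> g = (\<Sum>c\<in>D'. c g)" for g
  \<comment> \<open>The sum of \<open>S c * c g\<close> over all characters is computed twice: from
    the definition of \<open>S\<close> by orthogonality, and from the formula
    \<open>S_eq\<close>.\<close>
  have \<phi>_eq: "of_int d * \<phi> g = of_int (n * of_bool (g \<in> D) - (k - s) - s * n * of_bool (g = \<one>))"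
    if g: "g \<in> carrier G" for g
  proof -
    have "(\<Sum>c\<in>carrier dual. S c * c g) = (\<Sum>x\<in>D. \<Sum>c\<in>carrier dual. c (x \<otimes> g))"
      unfolding S_def sum_distrib_right
      by (subst sum.swap) (use g Dsub in \<open>auto intro!: sum.cong simp: dual_mult\<close>)
    also have "\<dots> = (\<Sum>x\<in>D. if x = inv g then of_int n else 0)"
    proof (rule sum.cong[OF refl])
      fix x assume "x \<in> D"
      then have x: "x \<in> carrier G" using Dsub by blast
      have "x \<otimes> g = \<one> \<longleftrightarrow> x = inv g" using x g inv_equality l_inv by metis
      then show "(\<Sum>c\<in>carrier dual. c (x \<otimes> g)) = (if x = inv g then of_int n else 0)"
        using sum_over_dual[OF fin, of "x \<otimes> g"] x g by (simp add: n_def)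
    qed
    also have "\<dots> = of_int (n * of_bool (g \<in> D))"
    proof -
      have "inv g \<in> D \<longleftrightarrow> g \<in> D" using Dinv g inv_inv by metis
      then show ?thesis using finite_subset[OF Dsub fin] by simp
    qed
    finally have 1: "(\<Sum>c\<in>carrier dual. S c * c g) = of_int (n * of_bool (g \<in> D))" .
    have "(\<Sum>c\<in>carrier dual. S c * c g) = (\<Sum>c\<in>carrier dual. of_int s * c g
        + of_int d * (of_bool (c \<in> D') * c g) + (if c = \<one>\<^bsub>dual\<^esub> then of_int (k - s) else 0))"
      by (intro sum.cong refl) (use g in \<open>auto simp: S_eq algebra_simps dual_group_one_apply\<close>)
    also have "\<dots> = of_int s * (if g = \<one> then of_int n else 0) + of_int d * \<phi> g + of_int (k - s)"
      using finD sum_over_dual[OF fin g]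
      by (simp add: sum.distrib sum_distrib_left[symmetric] D.sum_indicator[OF finD D'sub] \<phi>_def n_def)
    finally show ?thesis using 1 by (simp add: algebra_simps)
  qed
  have n2: "2 \<le> n" "k \<le> n - 2" using assms(5) by (auto simp: n_def k_def)
  obtain a where a: "a \<in> carrier dual" "a \<noteq> \<one>\<^bsub>dual\<^esub>"
  proof -
    have "card (carrier dual) \<noteq> card {\<one>\<^bsub>dual\<^esub>}"
      using order_dual[OF fin] n2 by (simp add: order_def n_def)
    then have "carrier dual \<noteq> {\<one>\<^bsub>dual\<^esub>}" by metis
    then show thesis using that D.one_closed by blast
  qed
  obtain t where t: "S a = of_int t" "t = r \<or> t = s" using Srs[OF a] by blast
  \<comment> \<open>Up to sign, \<open>C\<close> is the determinant of the linear system for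
    \<open>\<alpha>^j\<close> and \<open>\<gamma>^j\<close> below. It is positive if
    \<open>t = r\<close> and, because \<open>k \<le> n - 2\<close>, negative if
    \<open>t = s\<close>.\<close>
  define C where "C = k + t * (n - 1)"
  have C0: "C \<noteq> 0"
    using t(2)
  proof
    assume "t = r"
    then have "0 < t * (n - 1)" using r n2 by simp
    then show ?thesis by (simp add: C_def k_def)
  next
    assume "t = s"
    then have "t * (n - 1) \<le> (-1) * (n - 1)" using s n2 by (intro mult_right_mono) auto
    then show ?thesis using n2 by (simp add: C_def)
  qed
  define \<alpha> \<gamma> :: complex where "\<alpha> = of_int (n - (k - s)) / of_int d" and "\<gamma> = of_int (- (k - s)) / of_int d"
  have phi_D: "\<phi> g = \<alpha>" if "g \<in> D" for g
  proof -
    have "g \<in> carrier G" "g \<noteq> \<one>" using that Dsub D1 by auto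
    then show ?thesis using \<phi>_eq[of g] that d0 by (simp add: \<alpha>_def field_simps)
  qed
  have phi_nD: "\<phi> g = \<gamma>" if "g \<in> carrier G - D - {\<one>}" for g
    using \<phi>_eq[of g] that d0 by (auto simp: \<gamma>_def field_simps)
  have phi_1: "\<phi> \<one> = of_int (int (card D'))"
  proof -
    have "\<phi> \<one> = (\<Sum>c\<in>D'. 1)" unfolding \<phi>_def
      by (intro sum.cong refl) (use D'sub in \<open>auto simp: dual_at_one\<close>)
    then show ?thesis by simp
  qed
  \<comment> \<open>The left side is the sum of \<open>\<phi>^j c\<close> over the nonidentity
    elements: an integral Fourier coefficient minus the identity term
    \<open>(card D')^j\<close>.\<close>
  have T: "\<exists>N::int. \<alpha> ^ j * S c + \<gamma> ^ j * ((\<Sum>g\<in>carrier G. c g) - 1 - S c) = of_int N"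
    if c: "c \<in> carrier dual" for c j
  proof -
    obtain w :: "('a \<Rightarrow> complex) \<Rightarrow> int"
      where w: "\<And>g. g \<in> carrier G \<Longrightarrow> \<phi> g ^ j = (\<Sum>c\<in>carrier dual. of_int (w c) * c g)"
      using dual_sum_power[OF fin D'sub, of j] unfolding \<phi>_def by blast
    have "(\<Sum>g\<in>carrier G. \<phi> g ^ j * c g) = of_int (int (order G) * w (inv\<^bsub>dual\<^esub> c))"
      using dual_fourier_coefficient[OF fin c, of w] w by simp
    moreover have "(\<Sum>g\<in>carrier G. \<phi> g ^ j * c g) = (\<Sum>g\<in>carrier G.
        (\<alpha> ^ j - \<gamma> ^ j) * (of_bool (g \<in> D) * c g) + \<gamma> ^ j * c g
        + (if g = \<one> then (of_int (int (card D')) ^ j - \<gamma> ^ j) else 0))"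
    proof (rule sum.cong[OF refl])
      fix g assume "g \<in> carrier G"
      then consider "g \<in> D" "g \<noteq> \<one>" | "g = \<one>" "g \<notin> D" | "g \<in> carrier G - D - {\<one>}" using D1 by blast
      then show "\<phi> g ^ j * c g = (\<alpha> ^ j - \<gamma> ^ j) * (of_bool (g \<in> D) * c g) + \<gamma> ^ j * c g
        + (if g = \<one> then (of_int (int (card D')) ^ j - \<gamma> ^ j) else 0)"
        by cases (auto simp: phi_D phi_nD phi_1 dual_at_one[OF c] algebra_simps)
    qed
    moreover have "\<dots> = (\<alpha> ^ j - \<gamma> ^ j) * S c + \<gamma> ^ j * (\<Sum>g\<in>carrier G. c g)
        + (of_int (int (card D')) ^ j - \<gamma> ^ j)"
      using fin by (simp add: sum.distrib sum_distrib_left[symmetric] sum_indicator[OF fin Dsub] S_def)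
    ultimately have "\<alpha> ^ j * S c + \<gamma> ^ j * ((\<Sum>g\<in>carrier G. c g) - 1 - S c) =
        of_int (int (order G) * w (inv\<^bsub>dual\<^esub> c) - int (card D') ^ j)"
      by (simp add: algebra_simps)
    then show ?thesis by blast
  qed
  \<comment> \<open>Cramer's rule for the two equations that \<open>T\<close> yields for the trivial
    character and for \<open>a\<close>.\<close>
  have pw: "\<exists>N M::int. of_int C * \<gamma> ^ j = of_int N \<and> of_int C * \<alpha> ^ j = of_int M" for j
  proof -
    obtain N1 :: int where N1: "\<alpha> ^ j * of_int k + \<gamma> ^ j * (of_int n - 1 - of_int k) = of_int N1"
      using T[OF D.one_closed, of j] sum_dual_apply[OF fin D.one_closed] by (auto simp: S1 n_def)
    obtain N2 :: int where N2: "\<alpha> ^ j * of_int t + \<gamma> ^ j * (- 1 - of_int t) = of_int N2"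
      using T[OF a(1), of j] sum_dual_apply[OF fin a(1)] a(2) by (auto simp: t)
    have "of_int C * \<gamma> ^ j = of_int t * (\<alpha> ^ j * of_int k + \<gamma> ^ j * (of_int n - 1 - of_int k))
        - of_int k * (\<alpha> ^ j * of_int t + \<gamma> ^ j * (- 1 - of_int t))"
      by (simp add: C_def algebra_simps)
    also have "\<dots> = of_int (t * N1 - k * N2)" by (simp add: N1 N2)
    finally have 1: "of_int C * \<gamma> ^ j = of_int (t * N1 - k * N2)" .
    have "of_int C * \<alpha> ^ j = (1 + of_int t) * (\<alpha> ^ j * of_int k + \<gamma> ^ j * (of_int n - 1 - of_int k))
        + (of_int n - 1 - of_int k) * (\<alpha> ^ j * of_int t + \<gamma> ^ j * (- 1 - of_int t))"
      by (simp add: C_def algebra_simps)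
    also have "\<dots> = of_int ((1 + t) * N1 + (n - 1 - k) * N2)" by (simp add: N1 N2)
    finally show ?thesis using 1 by blast
  qed
  have dvd_aux: "d dvd x"
    if pow_int: "\<And>j. \<exists>N::int. of_int C * (of_int x / of_int d :: complex) ^ j = of_int N" for x
  proof (rule dvd_if_power_dvd_multiple[OF C0])
    show "d \<noteq> 0" using d0 by simp
    fix j
    obtain N :: int where "of_int C * (of_int x / of_int d :: complex) ^ j = of_int N"
      using pow_int by blast
    then have "(of_int (C * x ^ j) :: complex) = of_int (N * d ^ j)"
      using d0 by (simp add: field_simps)
    then have "C * x ^ j = N * d ^ j" by (simp only: of_int_eq_iff)
    then show "d ^ j dvd C * x ^ j" by simp
  qed
  have dvd1: "d dvd - (k - s)" using dvd_aux pw unfolding \<gamma>_def by blast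
  have "d dvd n - (k - s)" using dvd_aux pw unfolding \<alpha>_def by blast
  then have "d dvd (n - (k - s)) - (- (k - s))" using dvd1 by (rule dvd_diff)
  then obtain d' where d': "n = d * d'" by (auto elim: dvdE)
  from dvd1 obtain \<gamma>' where \<gamma>': "- (k - s) = d * \<gamma>'" by (auto elim: dvdE)
  \<comment> \<open>Chosen so that \<open>\<gamma>' = - (A + 1)\<close> is the smaller eigenvalue of
    \<open>D'\<close>; the larger one is \<open>\<gamma>' + d'\<close>.\<close>
  define A where "A = - \<gamma>' - 1"
  have d'0: "0 < d'" using n2 d0 d' by (metis zero_less_mult_pos linorder_not_le order_less_le_trans zero_less_numeral)
  have \<phi>_int: "\<phi> g = of_int (\<gamma>' + d' * of_bool (g \<in> D) - s * d' * of_bool (g = \<one>))"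
    if g: "g \<in> carrier G" for g
  proof -
    have "of_int d * \<phi> g = of_int d * of_int (\<gamma>' + d' * of_bool (g \<in> D) - s * d' * of_bool (g = \<one>))"
      unfolding \<phi>_eq[OF g] of_int_mult[symmetric] of_int_eq_iff using \<gamma>' d' by (simp add: algebra_simps)
    then show ?thesis using d0 by simp
  qed
  let ?e = "\<lambda>c. of_bool (c \<in> D') :: int"
  \<comment> \<open>Fourier inversion of \<open>\<phi>^2\<close> gives \<open>n\<close> times the
    convolution; cancelling \<open>d'\<close> leaves the factor \<open>d\<close>, which would not
    visibly divide the constant term.\<close>
  have conv: "d * gconv dual ?e ?e c = - d * ((d' + \<gamma>') * \<gamma>') * of_bool (c = \<one>\<^bsub>dual\<^esub>)
      + d * (d' + 2 * \<gamma>') * ?e c + s * d' * (1 + s)"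
    if c: "c \<in> carrier dual" for c
  proof -
    have sq: "(\<Sum>c\<in>carrier dual. of_int (gconv dual ?e ?e c) * c g) = (\<phi> g)\<^sup>2" if g: "g \<in> carrier G" for g
      using D.sum_gconv_mult[of "\<lambda>c. c g" ?e ?e] D.sum_indicator[OF finD D'sub, of "\<lambda>c. c g"] g
      by (simp add: dual_group_mult_apply \<phi>_def power2_eq_square)
    have ic: "inv\<^bsub>dual\<^esub> c \<in> carrier dual" using c by simp
    have "of_int (n * gconv dual ?e ?e c) = (\<Sum>g\<in>carrier G. (\<phi> g)\<^sup>2 * (inv\<^bsub>dual\<^esub> c) g)"
      using dual_fourier_coefficient[OF fin ic, of "gconv dual ?e ?e"] c sq by (simp add: n_def)
    also have "\<dots> = (\<Sum>g\<in>carrier G. of_int (\<gamma>'\<^sup>2) * (inv\<^bsub>dual\<^esub> c) g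
        + of_int (2 * \<gamma>' * d' + d'\<^sup>2) * (of_bool (g \<in> D) * (inv\<^bsub>dual\<^esub> c) g)
        + (if g = \<one> then of_int (s\<^sup>2 * d'\<^sup>2 - 2 * \<gamma>' * s * d') else 0))"
      by (intro sum.cong refl)
        (use D1 in \<open>auto simp: \<phi>_int dual_at_one[OF ic] power2_eq_square algebra_simps\<close>)
    also have "\<dots> = of_int (\<gamma>'\<^sup>2) * (\<Sum>g\<in>carrier G. (inv\<^bsub>dual\<^esub> c) g)
        + of_int (2 * \<gamma>' * d' + d'\<^sup>2) * S (inv\<^bsub>dual\<^esub> c) + of_int (s\<^sup>2 * d'\<^sup>2 - 2 * \<gamma>' * s * d')"
      using fin by (simp add: sum.distrib sum_distrib_left[symmetric] sum_indicator[OF fin Dsub] S_def)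
    also have "\<dots> = of_int (\<gamma>'\<^sup>2 * (n * of_bool (c = \<one>\<^bsub>dual\<^esub>))
        + (2 * \<gamma>' * d' + d'\<^sup>2) * (s + d * ?e c + (k - s) * of_bool (c = \<one>\<^bsub>dual\<^esub>))
        + (s\<^sup>2 * d'\<^sup>2 - 2 * \<gamma>' * s * d'))"
    proof -
      have "inv\<^bsub>dual\<^esub> c = \<one>\<^bsub>dual\<^esub> \<longleftrightarrow> c = \<one>\<^bsub>dual\<^esub>" using c by simp
      then show ?thesis
        unfolding S_inv[OF c] S_eq[OF c] sum_dual_apply[OF fin ic] by (simp add: n_def)
    qed
    finally have "n * gconv dual ?e ?e c = \<gamma>'\<^sup>2 * (n * of_bool (c = \<one>\<^bsub>dual\<^esub>))
        + (2 * \<gamma>' * d' + d'\<^sup>2) * (s + d * ?e c + (k - s) * of_bool (c = \<one>\<^bsub>dual\<^esub>))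
        + (s\<^sup>2 * d'\<^sup>2 - 2 * \<gamma>' * s * d')"
      by (simp only: of_int_eq_iff)
    moreover have "k - s = - (d * \<gamma>')" using \<gamma>' by simp
    ultimately have "d' * (d * gconv dual ?e ?e c) = d' * (- d * ((d' + \<gamma>') * \<gamma>') * of_bool (c = \<one>\<^bsub>dual\<^esub>)
      + d * (d' + 2 * \<gamma>') * ?e c + s * d' * (1 + s))"
      using d' by (simp add: power2_eq_square algebra_simps)
    then show ?thesis using d'0 by simp
  qed
  \<comment> \<open>Read off from the coefficient at the identity, which makes it an integer by
    construction.\<close>
  define m' where "m' = gconv dual ?e ?e \<one>\<^bsub>dual\<^esub> + (d' + \<gamma>') * \<gamma>'"
  have D'1: "\<one>\<^bsub>dual\<^esub> \<notin> D'" by (simp add: D'_def)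
  have m': "d * m' = s * d' * (1 + s)"
    using conv[OF D.one_closed] D'1 by (simp add: m'_def algebra_simps)
  have "pds_equation dual D' (d' - (A + 1)) (- (A + 1)) m'"
    unfolding pds_equation_def
  proof (intro conjI ballI)
    fix c assume "c \<in> D'"
    then show "inv\<^bsub>dual\<^esub> c \<in> D'" using S_inv by (auto simp: D'_def)
  next
    fix c assume c: "c \<in> carrier dual"
    have "d * gconv dual ?e ?e c = d * (- ((d' + \<gamma>') * \<gamma>') * of_bool (c = \<one>\<^bsub>dual\<^esub>)
      + (d' + 2 * \<gamma>') * ?e c + m')"
      unfolding conv[OF c] m'[symmetric] by (simp add: algebra_simps)
    then show "gconv dual ?e ?e c = - ((d' - (A + 1)) * - (A + 1)) * of_bool (c = \<one>\<^bsub>dual\<^esub>)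
        + (d' - (A + 1) + - (A + 1)) * ?e c + m'"
      using d0 by (simp add: A_def)
  qed (use D'sub D'1 in auto)
  moreover have "int (card D') + (A + 1) = d' * (- s)"
  proof -
    have "of_int (int (card D')) = (of_int (\<gamma>' - s * d') :: complex)"
      unfolding phi_1[symmetric] \<phi>_int[OF one_closed] using D1 by simp
    then have "int (card D') = \<gamma>' - s * d'" by (simp only: of_int_eq_iff)
    then show ?thesis by (simp add: A_def)
  qed
  moreover have "int (card D) - s = (r - s) * (A + 1)" using \<gamma>' by (simp add: A_def k_def d_def)
  moreover have "(r - s) * d' = int (order G)" using d' by (simp add: n_def d_def)
  ultimately show thesis using that by blast
qed

end

section \<open>Groups of order eight times an odd prime cube\<close>

text \<open>The counting identity supplies the integer \<open>B\<close> with
  \<open>p B = A (A + 1)\<close> and \<open>8 m = h^2 B\<close>, after which the quotient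
  inequalities apply. The group is arbitrary so that the dual can be inserted too.\<close>

lemma gap_four_or_eight_times_prime_impossible:
  fixes G (structure) and p :: nat
  assumes G: "comm_group G" and fin: "finite (carrier G)" and ord: "order G = 8 * p ^ 3"
    and p: "prime p" "odd p" and D: "pds_equation G D r s m"
    and h: "h = 4 \<or> h = 8" and rs: "r - s = h * int p" and dd: "h * int p * d' = 8 * int p ^ 3"
    and k: "int (card D) - s = h * int p * (A + 1)" and A: "0 < A" "A < d' - 1"
    and eq: "d' * (b * (h * int p - 1 - b)) = h * int p * (A * (d' - 1 - A))"
  shows False
proof -
  interpret comm_group G by fact
  have p': "prime (int p)" "odd (int p)" using p by auto
  have p0: "int p \<noteq> 0" using p by (auto dest: prime_gt_0_nat)
  have "(h * int p * A) * (h * int p * (A + 1)) = m * (8 * int p ^ 3)"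
  proof -
    have "int (card D) - r = h * int p * A" using k rs by (simp add: algebra_simps)
    then show ?thesis using pds_equation_counts(2)[OF fin D] k ord by simp
  qed
  then have "(int p * int p) * (h\<^sup>2 * (A * (A + 1))) = (int p * int p) * (8 * m * int p)"
    by (simp add: power2_eq_square power3_eq_cube algebra_simps)
  then have e: "h\<^sup>2 * (A * (A + 1)) = 8 * m * int p" using p0 by simp
  have "coprime (int p) (h\<^sup>2)"
  proof -
    have "coprime (int p) (2 ^ 4)" "coprime (int p) (2 ^ 6)"
      unfolding coprime_power_right_iff using p'(2) by simp_all
    moreover have "h\<^sup>2 = 2 ^ 4 \<or> h\<^sup>2 = 2 ^ 6" using h by auto
    ultimately show ?thesis by metis
  qed
  moreover have "int p dvd h\<^sup>2 * (A * (A + 1))" unfolding e by simp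
  ultimately have "int p dvd A * (A + 1)" by (simp only: coprime_dvd_mult_right_iff)
  then obtain B where B: "int p * B = A * (A + 1)" by (metis dvdE)
  have "h\<^sup>2 * (int p * B) = 8 * m * int p" using e by (simp only: B)
  then have "int p * (h\<^sup>2 * B) = int p * (8 * m)" by (simp only: algebra_simps)
  then have m: "8 * m = h\<^sup>2 * B" using p0 by simp
  have "odd (p ^ 3)" using p(2) by simp
  from odd_quotient_inequalities[OF G fin ord this D h rs m k]
  obtain e where "(A + 1) * int p - e \<le> int p * e + B - e\<^sup>2"
    "3 * ((A + 1) * int p - e) \<le> int p * e + B - e\<^sup>2 + 2 * (int (p ^ 3) - 1)" by blast
  then show False
    using quotient_inequalities_contradiction[OF p' h dd A B eq] by simp
qed

text \<open>Since \<open>d d' = 8 p^3\<close>, one of \<open>d\<close> and \<open>d'\<close> is not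
  divisible by \<open>p^2\<close>; the excluded cases are applied to \<open>G\<close> or to its dual
  accordingly.\<close>

lemma no_nontrivial_pds_equation:
  fixes G (structure) and p :: nat
  assumes G: "comm_group G" and fin: "finite (carrier G)" and ord: "order G = 8 * p ^ 3"
    and p: "prime p" "odd p" and D: "pds_equation G D r s m"
    and r: "0 < r" and s: "s < - 1" and k: "card D + 1 < order G"
  shows False
proof -
  interpret comm_group G by fact
  obtain d' A m' D' where
    n: "(r - s) * d' = int (order G)" and kA: "int (card D) - s = (r - s) * (A + 1)"
    and D': "pds_equation dual D' (d' - (A + 1)) (- (A + 1)) m'"
    and kD': "int (card D') + (A + 1) = d' * (- s)"
    by (rule dual_partial_difference_set[OF fin D r _ k]) (use s in simp, blast)
  define d where "d = r - s"
  define b where "b = - s - 1"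
  have p': "prime (int p)" "odd (int p)" using p by auto
  have dd: "d * d' = 8 * int p ^ 3" using n ord by (simp add: d_def)
  have d0: "0 < d" using r s by (simp add: d_def)
  have b: "0 < b" "b < d - 1" using r s by (auto simp: b_def d_def)
  have d'0: "0 < d'"
  proof (rule ccontr)
    assume "\<not> 0 < d'"
    then have "d * d' \<le> 0" using d0 by (simp add: mult_le_0_iff)
    then show False using dd p by (simp add: prime_gt_0_nat)
  qed
  \<comment> \<open>Here \<open>d - 1 - b = r\<close>, so
    \<open>b (d - 1 - b) = - r s - r = d A - m\<close>, and the second counting identity becomes
    \<open>d A (A + 1) = m d'\<close>.\<close>
  have eq: "d' * (b * (d - 1 - b)) = d * (A * (d' - 1 - A))"
  proof -
    have "int (card D) - r = d * A" using kA by (simp add: d_def algebra_simps)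
    then have "(d * A) * (d * (A + 1)) = m * (d * d')"
      using pds_equation_counts(2)[OF fin D] kA n by (simp add: d_def)
    then have "d * (d * A * (A + 1)) = d * (m * d')" by (simp add: algebra_simps)
    then have 1: "d * A * (A + 1) = m * d'" using d0 by simp
    have "b * (d - 1 - b) = d * A - m"
      using pds_equation_counts(1)[OF fin D] \<open>int (card D) - r = d * A\<close>
      by (simp add: b_def d_def algebra_simps)
    then have "d' * (b * (d - 1 - b)) = d * A * d' - m * d'" by (simp add: right_diff_distrib)
    also have "\<dots> = d * A * d' - d * A * (A + 1)" by (simp only: 1)
    finally show ?thesis by (simp add: algebra_simps)
  qed
  have A: "0 < A" "A < d' - 1"
  proof -
    have "0 < d * (A * (d' - 1 - A))" unfolding eq[symmetric] using b d'0 by simp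
    then have "0 < A * (d' - 1 - A)" using d0 by (simp add: zero_less_mult_iff)
    then show "0 < A" "A < d' - 1" using d'0 by (auto simp: zero_less_mult_iff)
  qed
  have small: False if "d \<in> {1, 2, 4, 8, int p, 2 * int p}"
    using no_small_eigenvalue_gap[OF p' dd that b A eq] .
  \<comment> \<open>The parameter equation is symmetric under exchanging \<open>(d, b)\<close> with
    \<open>(d', A)\<close>.\<close>
  have small': False if "d' \<in> {1, 2, 4, 8, int p, 2 * int p}"
    using no_small_eigenvalue_gap[OF p' _ that A b eq[symmetric]] dd by (simp add: mult.commute)
  have mid: False if "d = h * int p" "h = 4 \<or> h = 8" for h
    using gap_four_or_eight_times_prime_impossible[OF G fin ord p D that(2), of d' A b] that A eq dd kA
    by (simp add: d_def)
  \<comment> \<open>The dual difference set has smaller eigenvalue \<open>- (A + 1)\<close>, and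
    \<open>b\<close> takes over the role of \<open>A\<close>.\<close>
  have mid': False if "d' = h * int p" "h = 4 \<or> h = 8" for h
  proof (rule gap_four_or_eight_times_prime_impossible[OF _ _ _ p D' that(2), of d b A])
    show "comm_group dual" by (rule comm_group_dual_group) unfold_locales
    show "finite (carrier dual)" by (rule finite_dual[OF fin])
    show "order dual = 8 * p ^ 3" using order_dual[OF fin] ord by simp
  qed (use that b eq dd kD' in \<open>auto simp: b_def mult.commute\<close>)
  have "nat d dvd 8 * p ^ 3"
  proof -
    have "d dvd int (8 * p ^ 3)" using dd by (metis dvd_triv_left of_nat_mult of_nat_numeral of_nat_power)
    then show ?thesis using d0 by (simp add: nat_dvd_iff)
  qed
  then obtain x y where xy: "nat d = x * y" "x dvd 8" "y dvd p ^ 3"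
    using division_decomp by blast
  obtain j where j: "j \<le> 3" "y = p ^ j" using xy(3) p(1) by (auto simp: divides_primepow_nat)
  have "x \<le> 8" using xy(2) dvd_imp_le by simp
  then have "x \<in> {0..8}" by simp
  also have "{0..8} = {0, 1, 2, 3, 4, 5, 6, 7, 8::nat}" by auto
  finally have x: "x \<in> {1, 2, 4, 8}" using xy(2) by auto
  have dxy: "d = int x * int p ^ j" using xy(1) j(2) d0 by (simp add: nat_eq_iff)
  have pj: "int p ^ j \<noteq> 0" using p by (simp add: prime_gt_0_nat)
  have "int x * int p ^ j * d' = 8 * (int p ^ j * int p ^ (3 - j))"
    using dd dxy j(1) by (simp flip: power_add)
  then have xd': "int x * d' = 8 * int p ^ (3 - j)" using pj by auto
  have "j = 0 \<or> j = 1 \<or> j = 2 \<or> j = 3" using j(1) by auto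
  \<comment> \<open>With \<open>d = x p^j\<close> and \<open>x\<close> dividing 8, the cases
    \<open>j \<le> 1\<close> are excluded through \<open>d\<close>, the cases
    \<open>j \<ge> 2\<close> through \<open>d'\<close>, where
    \<open>x d' = 8 p^(3 - j)\<close>.\<close>
  then consider "j = 0" | "j = 1" | "j = 2" | "j = 3" by blast
  then show False
  proof cases
    case 1
    then show False using small dxy x by auto
  next
    case 2
    then show False using small mid[of "int x"] dxy x by auto
  next
    case 3
    then show False using small' mid'[of 4] mid'[of 8] xd' x by auto
  next
    case 4
    then show False using small' xd' x by auto
  qed
qed

section \<open>From the combinatorial definition to the group ring equation\<close>

lemma regular_pds_gconv:
  fixes G (structure)
  assumes D: "regular_partial_difference_set G v k l m D"
  shows "D \<subseteq> carrier G" "\<one> \<notin> D" "\<And>x. x \<in> D \<Longrightarrow> inv x \<in> D"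
    and "z \<in> carrier G \<Longrightarrow> gconv G (\<lambda>x. of_bool (x \<in> D)) (\<lambda>x. of_bool (x \<in> D)) z =
      (int k - int m) * of_bool (z = \<one>) + (int l - int m) * of_bool (z \<in> D) + int m"
proof -
  have G: "comm_group G" and fin: "finite (carrier G)" and Dsub: "D \<subseteq> carrier G" and k: "card D = k"
    and l: "\<And>x. x \<in> D - {\<one>} \<Longrightarrow> card (quotient_reps G D x) = l"
    and m: "\<And>x. x \<in> carrier G - D - {\<one>} \<Longrightarrow> card (quotient_reps G D x) = m"
    and D1: "\<one> \<notin> D" and Dset: "set_inv D = D"
    using D unfolding regular_partial_difference_set_def partial_difference_set_def by auto
  interpret comm_group G by fact
  show "D \<subseteq> carrier G" "\<one> \<notin> D" by fact+
  show Dinv: "inv x \<in> D" if "x \<in> D" for x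
    using Dset that unfolding SET_INV_def by blast
  assume z: "z \<in> carrier G"
  have conv: "gconv G (\<lambda>x. of_bool (x \<in> D)) (\<lambda>x. of_bool (x \<in> D)) z = int (card {x \<in> D. inv x \<otimes> z \<in> D})"
    by (rule gconv_indicator[OF fin Dsub])
  show "gconv G (\<lambda>x. of_bool (x \<in> D)) (\<lambda>x. of_bool (x \<in> D)) z =
      (int k - int m) * of_bool (z = \<one>) + (int l - int m) * of_bool (z \<in> D) + int m"
  proof (cases "z = \<one>")
    case True
    have "{x \<in> D. inv x \<otimes> z \<in> D} = D" using True Dinv Dsub by auto
    then show ?thesis using conv k D1 True by simp
  next
    case False
    \<comment> \<open>A representation \<open>z = g h^-1\<close> corresponds to
      \<open>x = g\<close>, because \<open>x^-1 z = h^-1\<close> lies in \<open>D\<close> exactly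
      when \<open>h\<close> does. The two entries differ since \<open>z\<close> is not the
      identity.\<close>
    have "bij_betw (\<lambda>x. (x, inv (inv x \<otimes> z))) {x \<in> D. inv x \<otimes> z \<in> D} (quotient_reps G D z)"
    proof (rule bij_betwI[where g = fst])
      show "(\<lambda>x. (x, inv (inv x \<otimes> z))) \<in> {x \<in> D. inv x \<otimes> z \<in> D} \<rightarrow> quotient_reps G D z"
      proof
        fix x assume "x \<in> {x \<in> D. inv x \<otimes> z \<in> D}"
        then have x: "x \<in> D" "x \<in> carrier G" "inv x \<otimes> z \<in> D" using Dsub by auto
        have e: "x \<otimes> (inv x \<otimes> z) = z" using x z by (simp add: m_assoc[symmetric])
        moreover have "x \<noteq> inv (inv x \<otimes> z)"
        proof
          assume "x = inv (inv x \<otimes> z)"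
          then have "x \<otimes> (inv x \<otimes> z) = inv (inv x \<otimes> z) \<otimes> (inv x \<otimes> z)" by simp
          also have "\<dots> = \<one>" using x z by (intro l_inv) simp
          finally show False using e False by simp
        qed
        ultimately show "(x, inv (inv x \<otimes> z)) \<in> quotient_reps G D z"
          using x z Dinv[OF x(3)] by (simp add: quotient_reps_def)
      qed
      have *: "inv (inv g \<otimes> z) = h" "inv g \<otimes> z \<in> D"
        if "(g, h) \<in> quotient_reps G D z" for g h
      proof -
        have gh: "g \<in> D" "h \<in> D" "g \<in> carrier G" "h \<in> carrier G" "g \<otimes> inv h = z"
          using that Dsub by (auto simp: quotient_reps_def)
        have "inv g \<otimes> z = inv h" using gh by (simp add: m_assoc[symmetric] flip: gh(5))
        then show "inv (inv g \<otimes> z) = h" "inv g \<otimes> z \<in> D" using gh Dinv by simp_all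
      qed
      show "fst \<in> quotient_reps G D z \<rightarrow> {x \<in> D. inv x \<otimes> z \<in> D}"
        using * by (auto simp: quotient_reps_def)
      show "(\<lambda>x. (x, inv (inv x \<otimes> z))) (fst y) = y" if "y \<in> quotient_reps G D z" for y
        using * that by (cases y) auto
    qed simp
    then have "card {x \<in> D. inv x \<otimes> z \<in> D} = card (quotient_reps G D z)" by (rule bij_betw_same_card)
    then show ?thesis using conv l[of z] m[of z] False z by (cases "z \<in> D") auto
  qed
qed

text \<open>In each extreme case a count equals its maximum, which forces closure:
  \<open>m = k\<close> makes \<open>G - D\<close> a subgroup, \<open>l = k - 1\<close> makes
  \<open>D\<close> with the identity one, and a \<open>D\<close> of size \<open>order G - 1\<close>
  gives the whole group.\<close>

lemma nontrivial_pds_parameters: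
  fixes G (structure)
  assumes D: "regular_partial_difference_set G v k l m D"
    and nt: "\<not> trivial_partial_difference_set G D"
  shows "m < k" "int l \<noteq> int k - 1" "card D + 1 < order G"
proof -
  have G: "comm_group G" and fin: "finite (carrier G)" and k: "card D = k"
    using D unfolding regular_partial_difference_set_def partial_difference_set_def by auto
  interpret comm_group G by fact
  note DD = regular_pds_gconv[OF D]
  have finD: "finite D" using finite_subset[OF DD(1) fin] .
  have conv: "int (card {x \<in> D. inv x \<otimes> z \<in> D}) =
      (int k - int m) * of_bool (z = \<one>) + (int l - int m) * of_bool (z \<in> D) + int m"
    if "z \<in> carrier G" for z
    using DD(4)[OF that] gconv_indicator[OF fin DD(1)] by simp
  have "D \<union> {\<one>} \<noteq> carrier G"
    using nt subgroup_self by (auto simp: trivial_partial_difference_set_def)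
  then obtain z where z: "z \<in> carrier G" "z \<notin> D" "z \<noteq> \<one>" using DD(1) by blast
  have "card (D \<union> {\<one>}) < card (carrier G)"
    using fin DD(1) z by (intro psubset_card_mono) auto
  then show "card D + 1 < order G" using finD DD(2) by (simp add: order_def)
  have "m \<noteq> k"
  proof
    assume "m = k"
    have all: "inv x \<otimes> w \<in> D" if "w \<in> carrier G - D" "x \<in> D" for w x
    proof -
      have "card {x \<in> D. inv x \<otimes> w \<in> D} = card D"
        using conv[of w] that(1) \<open>m = k\<close> k by simp
      then have "{x \<in> D. inv x \<otimes> w \<in> D} = D" using finD by (intro card_subset_eq) auto
      then show ?thesis using that(2) by blast
    qed
    have "subgroup (carrier G - D) G"
    proof (rule subgroupI)
      fix a assume "a \<in> carrier G - D"
      then show "inv a \<in> carrier G - D" using DD(3)[of "inv a"] by auto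
    next
      fix a b assume ab: "a \<in> carrier G - D" "b \<in> carrier G - D"
      have "a \<otimes> b \<notin> D"
      proof
        assume "a \<otimes> b \<in> D"
        then have "inv (a \<otimes> b) \<otimes> a \<in> D" using all ab(1) by blast
        moreover have "inv (a \<otimes> b) \<otimes> a = inv b" using ab by (simp add: inv_mult_group m_assoc)
        ultimately have "inv (inv b) \<in> D" using DD(3) by simp
        then show False using ab by simp
      qed
      then show "a \<otimes> b \<in> carrier G - D" using ab by simp
    qed (use DD(2) in auto)
    then show False using nt by (simp add: trivial_partial_difference_set_def)
  qed
  moreover have "int m \<le> int (card D)"
  proof -
    have "int m = int (card {x \<in> D. inv x \<otimes> z \<in> D})" using conv[OF z(1)] z by simp
    also have "\<dots> \<le> int (card D)" using finD by (simp add: card_mono)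
    finally show ?thesis .
  qed
  ultimately show "m < k" using k by simp
  show "int l \<noteq> int k - 1"
  proof
    assume l: "int l = int k - 1"
    \<comment> \<open>The choice \<open>x = w\<close> always fails because the identity is not in
      \<open>D\<close>; a count of \<open>k - 1\<close> therefore means that every other
      \<open>x\<close> succeeds.\<close>
    have all: "inv x \<otimes> w \<in> D" if "w \<in> D" "x \<in> D" "x \<noteq> w" for w x
    proof -
      have w: "w \<in> carrier G" "w \<noteq> \<one>" using that DD(1,2) by auto
      have "int (card {x \<in> D. inv x \<otimes> w \<in> D}) = int (card D) - 1"
        using conv[of w] that(1) w l k by simp
      moreover have "{x \<in> D. inv x \<otimes> w \<in> D} \<subseteq> D - {w}" using w DD(2) by auto
      moreover have "int (card (D - {w})) = int (card D) - 1"
        using card.remove[OF finD that(1)] by simp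
      ultimately have "{x \<in> D. inv x \<otimes> w \<in> D} = D - {w}"
        using finD by (intro card_subset_eq) auto
      then show ?thesis using that by blast
    qed
    have "subgroup (D \<union> {\<one>}) G"
    proof (rule subgroupI)
      fix a b assume ab: "a \<in> D \<union> {\<one>}" "b \<in> D \<union> {\<one>}"
      show "a \<otimes> b \<in> D \<union> {\<one>}"
      proof (cases "a = \<one> \<or> b = \<one> \<or> inv a = b")
        case True
        then show ?thesis using ab DD(1) by auto
      next
        case False
        then have "inv (inv a) \<otimes> b \<in> D" using ab DD(3) by (intro all) auto
        then show ?thesis using ab DD(1) by auto
      qed
    qed (use DD in auto)
    then show False using nt by (simp add: trivial_partial_difference_set_def)
  qed
qed

text \<open>A character of order 2 takes the values 1 and -1, so its sum \<open>t\<close> over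
  \<open>D\<close> is an integer root of \<open>t^2 = a + b t\<close>. The other root is
  \<open>b - t\<close>, and the product \<open>- a\<close> gives opposite signs.\<close>

lemma integral_pds_eigenvalues:
  fixes G (structure) and a b :: int
  assumes "comm_group G" and fin: "finite (carrier G)" and ev: "even (order G)"
    and D: "D \<subseteq> carrier G" and a: "0 < a"
    and eq: "\<And>z. z \<in> carrier G \<Longrightarrow>
      gconv G (\<lambda>x. of_bool (x \<in> D)) (\<lambda>x. of_bool (x \<in> D)) z =
        a * of_bool (z = \<one>) + b * of_bool (z \<in> D) + m"
  obtains r s where "0 < r" "s < 0" "r + s = b" "r * s = - a"
proof -
  interpret comm_group G by fact
  interpret D: comm_group dual by (rule comm_group_dual_group) unfold_locales
  have "even (order dual)" using order_dual[OF fin] ev by simp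
  then obtain c where c: "c \<in> carrier dual" "c \<noteq> \<one>\<^bsub>dual\<^esub>" "c \<otimes>\<^bsub>dual\<^esub> c = \<one>\<^bsub>dual\<^esub>"
    using D.even_order_involution[OF finite_dual[OF fin]] by blast
  have pm: "c x = 1 \<or> c x = - 1" if "x \<in> D" for x
  proof -
    have x: "x \<in> carrier G" using that D by blast
    have "c x * c x = 1" using c(3) dual_group_mult_apply[OF x] dual_group_one_apply[OF x] by metis
    then show ?thesis by (simp add: square_eq_1_iff)
  qed
  have "\<exists>t::int. (\<Sum>x\<in>D. c x) = of_int t"
  proof -
    have "(\<Sum>x\<in>D. c x) = (\<Sum>x\<in>D. of_int (if c x = 1 then 1 else - 1))"
      using pm by (intro sum.cong) auto
    then show ?thesis by (metis of_int_sum)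
  qed
  then obtain t :: int where t: "(\<Sum>x\<in>D. c x) = of_int t" by blast
  have "(of_int (t\<^sup>2) :: complex) = of_int (a + b * t)"
    using dual_sum_square[OF fin D c(1) eq c(2)] t by simp
  then have t2: "t\<^sup>2 = a + b * t" by (simp only: of_int_eq_iff)
  then have prod: "t * (b - t) = - a" by (simp add: power2_eq_square algebra_simps)
  then have "t * (b - t) < 0" using a by simp
  then consider "0 < t" "b - t < 0" | "t < 0" "0 < b - t" by (auto simp: mult_less_0_iff)
  then show thesis
  proof cases
    case 1
    then show thesis using that[of t "b - t"] prod by simp
  next
    case 2
    then show thesis using that[of "b - t" t] prod by (simp add: mult.commute)
  qed
qed

theorem theorem5:
  fixes G :: "('a, 'b) monoid_scheme" and p :: nat and D :: "'a set" and v k l m :: nat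
  assumes "prime p" and "odd p"
    and "comm_group G" and "order G = 8 * p ^ 3"
    and "regular_partial_difference_set G v k l m D"
  shows "trivial_partial_difference_set G D"
proof (rule ccontr)
  assume nt: "\<not> trivial_partial_difference_set G D"
  have fin: "finite (carrier G)"
    using assms(5) unfolding regular_partial_difference_set_def partial_difference_set_def by blast
  note DD = regular_pds_gconv[OF assms(5)]
  note params = nontrivial_pds_parameters[OF assms(5) nt]
  obtain r s where rs: "0 < r" "s < 0" "r + s = int l - int m" "r * s = - (int k - int m)"
    by (rule integral_pds_eigenvalues[OF assms(3) fin _ DD(1) _ DD(4)])
      (use assms(4) params(1) in auto)
  \<comment> \<open>If \<open>s = - 1\<close>, then \<open>r = k - m\<close>, and
    \<open>r + s = l - m\<close> would give \<open>l = k - 1\<close>.\<close>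
  have "s \<noteq> - 1" using rs params(2) by auto
  have "pds_equation G D r s (int m)"
    unfolding pds_equation_def using DD rs by simp
  then show False
    using no_nontrivial_pds_equation[OF assms(3) fin assms(4,1,2) _ rs(1) _ params(3)]
      rs(2) \<open>s \<noteq> - 1\<close> by force
qed

end
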